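(* Let $\mathcal S=\sum_{k=0}^\infty c_k$ be a formal series of complex numbers. Suppose $\mathcal S$ admits a first-order recurrence presentation $a(n)I_n+b(n)I_{n+1}=\mu_n$ ($n\ge n_0$), i.e. $$c_k=(-1)^k\mu_{n_0+k}\prod_{j=0}^{k-1}\frac{b(n_0+j)}{a(n_0+j+1)}\qquad(k\ge 0),$$ and suppose that for some solution $(I_n)_{n\ge n_0}$ of the recurrence the normalized tail $$R_N=a(n_0)\frac{I_{n_0+N}}{P(n_0+N,n_0)},\qquad P(n,n_0)=\prod_{k=n_0}^{n-1}\left(-\frac{a(k)}{b(k)}\right),$$ is $\mathcal M$-admissible. Then the quantity $$C(\mathcal S):=a(n_0)I_{n_0}-\mathrm{FP}_\infty(R)$$ exists and is well defined in the following sense: 1. It is independent of the choice of solution $(I_n)$ (among solutions with $\mathcal M$-admissible normalized tail). 2. It is independent of the chosen admissible recurrence presentation of $\mathcal S$: any two recurrence presentations of $\mathcal S$, each with a solution whose normalized tail is $\mathcal M$-admissible, yield the same value. 3. If $\mathcal S$ is convergent and $C$-summable, then $C(\mathcal S)$ equals the ordinary sum of $\mathcal S$. 4. $C$-summation is homogeneous: for every $\lambda\in\mathbb C$, the series $\sum_k\lambda c_k$ is $C$-summable and $C(\sum_k\lambda c_k)=\lambda\,C(\mathcal S)$. 5. If, in addition, the normalized tail is shift compatible, meaning that the shifted tail $R^+=(R_{N+1})_{N\ge0}$ is $\mathcal M$-admissible and $\mathrm{FP}_\infty(R)=\mathrm{FP}_\infty(R^+)$, then $C$-summation is stable for $\mathcal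 S$: the series $\sum_{k=1}^\infty c_k$ (reindexed from $0$) is $C$-summable and $c_0+C\left(\sum_{k=1}^\infty c_k\right)=C(\mathcal S)$.
   Context: **Germs and log-exp monomials.** Functions are germs at $+\infty$ on the positive real axis: two are identified if they agree for all sufficiently large real $x$. Put $\ell_0(x)=x$, $\ell_{j+1}(x)=\log\ell_j(x)$. $\mathcal P$ is the group of germs $\prod_{j=0}^r\ell_j(x)^{\alpha_j}$, $\alpha_j\in\mathbb R$. Let $\mathcal L_0=\mathcal P$. Given $\mathcal L_{\le h}=\bigcup_{q=0}^h\mathcal L_q$, a reduced exponent of height at most $h$ is a finite (possibly empty) sum $\Phi=\sum_\nu c_\nu M_\nu$ with $c_\nu\in\mathbb R\setminus\{0\}$, the $M_\nu\in\mathcal L_{\le h}$ distinct, each $M_\nu(x)\to+\infty$, and no $M_\nu$ equal to an iterated logarithm $\ell_j$ with $j\ge1$. $\mathcal L_{h+1}$ is the set of germs $\exp(\Phi(x))P(x)$ with $P\in\mathcal P$ and $\Phi$ a reduced exponent of height at most $h$; $\mathcal L=\bigcup_{h\ge0}\mathcal L_h$. The reduced expression is part of the data of an element of $\mathcal L$. Write $f\prec g$ (or $g\succ f$) if $f(x)/g(x)\to0$ as $x\to+\infty$. Let $\mathcal L_{<x}=\{L\in\mathcal L:\log L(x)=o(x)\}$. $L\in\mathcal L$ is gamma-resonant if there are $\lambda\in\mathbb R$, $H\in\mathcal L_{<x}$, $\kappa>0$ and $C\in\mathbb R_{>0}$ with $L(x)/(e^{\lambda x}H(x)\Gamma(\kappa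 x+1))\to C$. **Growth monomials, $\mathcal M$, $\mathcal M^\flat$.** A growth monomial is either a pure log-exp germ $L\in\mathcal L$ that is not gamma-resonant, or a gamma-type germ $e^{\lambda x}H(x)\Gamma(\kappa x+1)$ with $\lambda\in\mathbb R$, $H\in\mathcal L_{<x}$, $\kappa>0$. $\mathcal M$ consists of the zero germ and all finite sums $\sum_{j=1}^r(A_j+B_je^{i\pi x})M_j(x)$ with growth monomials $M_1\succ\cdots\succ M_r$ and $(A_j,B_j)\in\mathbb C^2\setminus\{(0,0)\}$. $\mathcal M^\flat$ consists of the zero germ and all finite sums $\sum_{j=1}^rC_jM_j(x)$ with growth monomials $M_1\succ\cdots\succ M_r$ and $C_j\in\mathbb C\setminus\{0\}$. The phase split of $c=\sum_j(A_j+B_je^{i\pi x})M_j\in\mathcal M$ is $c=c^{(+)}+e^{i\pi x}c^{(-)}$ with $c^{(+)}=\sum_jA_jM_j$, $c^{(-)}=\sum_jB_jM_j\in\mathcal M^\flat$. **Canonical continuation.** A growth monomial is continued to some right half-plane by replacing $x$ by $z$ in its reduced expression (principal branches of iterated logarithms and powers; for gamma-type, $M(z)=e^{\lambda z}H(z)\Gamma(\kappa z+1)$). $a=\sum C_jM_j\in\mathcal M^\flat$ is continued by $a(z)=\sum C_jM_j(z)$; the zero germ by $0$. **Bromwich transform.** $a\in\mathcal M^\flat$ is Bromwich-admissible if there is $\sigma_0\in\mathbb R$ such that for every $\sigma>\sigma_0$: (1) $\mathcal B[a](u)=\frac1{2\pi i}\int_{\sigma-i\infty}^{\sigma+i\infty}a(z)e^{-uz}\,dz$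 converges absolutely for almost every $u\in\mathbb R$; (2) $\mathcal B[a](u)$ does not depend on $\sigma>\sigma_0$; (3) for every sufficiently large integer $N$, $\int_{-\infty}^\infty\mathcal B[a](u)e^{Nu}\,du$ converges absolutely and equals $a(N)$. **Selectors.** For Bromwich-admissible $a$, $\mathcal S_+[a](N)=PV\int_{-\infty}^\infty\frac{\mathcal B[a](u)e^{Nu}}{1-e^u}du$, whenever the integral converges absolutely away from $u=0$ and the principal value $\lim_{\varepsilon\to0^+}\int_{|u|>\varepsilon}$ exists; $\mathcal S_-[a](N)=\int_{-\infty}^\infty\frac{\mathcal B[a](u)e^{Nu}}{1+e^u}du$, whenever it converges absolutely. $c\in\mathcal M$ admits a canonical selector if $c^{(\pm)}$ are Bromwich-admissible and $\mathcal S_+[c^{(+)}](N)$, $\mathcal S_-[c^{(-)}](N)$ exist for all sufficiently large $N$; then $U_c(N)=\mathcal S_+[c^{(+)}](N)+(-1)^N\mathcal S_-[c^{(-)}](N)$. **Admissibility and finite part.** A sequence $U$ (defined for large $N$) is shift-nonresonant if either $U_N\to0$ or there are $\varepsilon>0$, $N_0$ with $|U_N-U_{N+1}|\ge\varepsilon|U_N|$ for $N\ge N_0$. For a complex sequence $R=(R_N)_{N\ge0}$ put $c_N=R_N-R_{N+1}$. $R$ is $\mathcal M$-admissible if either $c_N=0$ for all large $N$, or there is $c\in\mathcal M$ with $c(N)=c_N$ for all large integers $N$ which admits a canonical selector $U_c$ that is shift-nonresonant (such $c$ is unique). For $\mathcal M$-admissible $R$, $\mathrm{FP}_\infty(R)$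 is the eventual constant value of $R_N$ if $c_N=0$ eventually, and otherwise the eventual constant value of $R_N-U_c(N)$. **Recurrence presentations and $C$-summation.** A recurrence presentation consists of $n_0\in\mathbb N$, functions $a,b:\mathbb N\to\mathbb C$ with $a(n)\ne0$, $b(n)\neq0$ for all $n\ge n_0$, and complex numbers $\mu_n$; it presents the formal series whose coefficients are the $c_k$ in the claim. Empty products are $1$. A formal series is $C$-summable if it has a recurrence presentation with some solution $(I_n)_{n\ge n_0}$ whose normalized tail $R$ is $\mathcal M$-admissible; its $C$-sum is then $a(n_0)I_{n_0}-\mathrm{FP}_\infty(R)$. *)

theory Defs
  imports "HOL-Analysis.Analysis"
begin

section \<open>Log-exp monomials\<close>

text \<open>
  Reduced expressions are syntactic objects, because the canonical continuation is read off from
  the expression. The expression \<open>LExp [(c1, M1), ..., (cn, Mn)] [a0, ..., ar]\<close> stands for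
  \<open>exp (c1 * M1 + ... + cn * Mn) * l0 powr a0 * ... * lr powr ar\<close>, where \<open>lj\<close> is the \<open>j\<close>-fold
  iterated logarithm. Germs at infinity are real functions compared by \<open>eventually ... at_top\<close>.
\<close>

datatype lexp = LExp "(real \<times> lexp) list" "real list"

definition iter_log :: "nat \<Rightarrow> 'a::ln \<Rightarrow> 'a" where
  "iter_log j = ln ^^ j"

text \<open>
  The evaluation is used at type \<^typ>\<open>real\<close> for the germ of an expression, and at type
  \<^typ>\<open>complex\<close>, where \<^const>\<open>ln\<close> and \<^const>\<open>powr\<close> are the principal branches, for its canonical
  continuation. The complex function is total, but only its values on a half-plane
  \<open>Re z > s\<close> with \<open>s\<close> large are the continuation; all notions below only use such values.
\<close>

fun lexp_eval :: "lexp \<Rightarrow> 'a::{real_normed_field,ln} \<Rightarrow> 'a" where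
  "lexp_eval (LExp \<Phi> \<alpha>) x =
     exp (\<Sum>(c, M)\<leftarrow>\<Phi>. of_real c * lexp_eval M x) *
     (\<Prod>j<length \<alpha>. iter_log j x powr of_real (\<alpha> ! j))"

definition germ_eq :: "(real \<Rightarrow> real) \<Rightarrow> (real \<Rightarrow> real) \<Rightarrow> bool" where
  "germ_eq f g \<longleftrightarrow> (\<forall>\<^sub>F x in at_top. f x = g x)"

definition dominates :: "(real \<Rightarrow> real) \<Rightarrow> (real \<Rightarrow> real) \<Rightarrow> bool"  (infix \<open>\<succ>\<^sub>g\<close> 50) where
  "g \<succ>\<^sub>g f \<longleftrightarrow> ((\<lambda>x. f x / g x) \<longlongrightarrow> 0) at_top"

definition reduced_exponent :: "lexp set \<Rightarrow> (real \<times> lexp) list \<Rightarrow> bool" where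
  "reduced_exponent A \<Phi> \<longleftrightarrow>
     (\<forall>(c, M)\<in>set \<Phi>.
        c \<noteq> 0 \<and> M \<in> A \<and> filterlim (lexp_eval M :: real \<Rightarrow> real) at_top at_top \<and>
        (\<forall>j\<ge>1. \<not> germ_eq (lexp_eval M) (iter_log j))) \<and>
     sorted_wrt (\<lambda>(_, M) (_, M'). \<not> germ_eq (lexp_eval M) (lexp_eval M')) \<Phi>"

text \<open>\<open>logexp_upto h\<close> is the union of the classes of height at most \<open>h\<close>.\<close>

primrec logexp_upto :: "nat \<Rightarrow> lexp set" where
  "logexp_upto 0 = {LExp [] \<alpha> | \<alpha>. True}"
| "logexp_upto (Suc h) =
     logexp_upto h \<union> {LExp \<Phi> \<alpha> | \<Phi> \<alpha>. reduced_exponent (logexp_upto h) \<Phi>}"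

definition logexp :: "lexp set" where
  "logexp = (\<Union>h. logexp_upto h)"

definition logexp_sublin :: "lexp set" where
  "logexp_sublin = {L \<in> logexp. (\<lambda>x::real. ln (lexp_eval L x)) \<in> o(\<lambda>x. x)}"


section \<open>Growth monomials and their combinations\<close>

definition gamma_germ :: "real \<Rightarrow> lexp \<Rightarrow> real \<Rightarrow> 'a::{Gamma,ln} \<Rightarrow> 'a" where
  "gamma_germ l H \<kappa> x = exp (of_real l * x) * lexp_eval H x * Gamma (of_real \<kappa> * x + 1)"

definition gamma_resonant :: "lexp \<Rightarrow> bool" where
  "gamma_resonant L \<longleftrightarrow>
     (\<exists>l H \<kappa> C. H \<in> logexp_sublin \<and> \<kappa> > 0 \<and> C > 0 \<and>
        ((\<lambda>x::real. lexp_eval L x / gamma_germ l H \<kappa> x) \<longlongrightarrow> C) at_top)"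

datatype gmono = Pure lexp | GammaType real lexp real

primrec gmono_eval :: "gmono \<Rightarrow> 'a::{Gamma,ln} \<Rightarrow> 'a" where
  "gmono_eval (Pure L) x = lexp_eval L x"
| "gmono_eval (GammaType l H \<kappa>) x = gamma_germ l H \<kappa> x"

primrec growth_monomial :: "gmono \<Rightarrow> bool" where
  "growth_monomial (Pure L) \<longleftrightarrow> L \<in> logexp \<and> \<not> gamma_resonant L"
| "growth_monomial (GammaType l H \<kappa>) \<longleftrightarrow> H \<in> logexp_sublin \<and> \<kappa> > 0"

text \<open>
  Elements of the classes \<open>M\<close> and \<open>M\<close>-flat, again as expressions: a list of terms in strictly
  decreasing order of growth. The empty list is the zero germ.
\<close>

definition MM :: "(complex \<times> complex \<times> gmono) list set" where
  "MM = {c. (\<forall>(A, B, M)\<in>set c. (A, B) \<noteq> (0, 0) \<and> growth_monomial M) \<and>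
            sorted_wrt (\<lambda>(_, _, M) (_, _, M'). gmono_eval M \<succ>\<^sub>g gmono_eval M') c}"

definition MM_flat :: "(complex \<times> gmono) list set" where
  "MM_flat = {a. (\<forall>(C, M)\<in>set a. C \<noteq> 0 \<and> growth_monomial M) \<and>
                 sorted_wrt (\<lambda>(_, M) (_, M'). gmono_eval M \<succ>\<^sub>g gmono_eval M') a}"

definition MM_germ :: "(complex \<times> complex \<times> gmono) list \<Rightarrow> real \<Rightarrow> complex" where
  "MM_germ c x =
     (\<Sum>(A, B, M)\<leftarrow>c. (A + B * exp (\<i> * of_real pi * of_real x)) * of_real (gmono_eval M x))"

definition phase_plus :: "(complex \<times> complex \<times> gmono) list \<Rightarrow> (complex \<times> gmono) list" where
  "phase_plus c = [(A, M). (A, B, M) \<leftarrow> c, A \<noteq> 0]"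

definition phase_minus :: "(complex \<times> complex \<times> gmono) list \<Rightarrow> (complex \<times> gmono) list" where
  "phase_minus c = [(B, M). (A, B, M) \<leftarrow> c, B \<noteq> 0]"

definition continuation :: "(complex \<times> gmono) list \<Rightarrow> complex \<Rightarrow> complex" where
  "continuation a z = (\<Sum>(C, M)\<leftarrow>a. C * gmono_eval M z)"


section \<open>Bromwich transform and selectors\<close>

text \<open>Integrand of the line integral over \<open>Re z = s\<close>, parametrised by \<open>z = s + i t\<close>.\<close>

definition bromwich_integrand ::
    "(complex \<times> gmono) list \<Rightarrow> real \<Rightarrow> real \<Rightarrow> real \<Rightarrow> complex" where
  "bromwich_integrand a s u t =
     continuation a (Complex s t) * exp (- (of_real u * Complex s t)) * \<i>"

definition bromwich_line :: "(complex \<times> gmono) list \<Rightarrow> real \<Rightarrow> real \<Rightarrow> complex" where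
  "bromwich_line a s u = 1 / (2 * of_real pi * \<i>) * (LINT t|lborel. bromwich_integrand a s u t)"

text \<open>The common value of the line integrals over all lines sufficiently far to the right.\<close>

definition bromwich :: "(complex \<times> gmono) list \<Rightarrow> real \<Rightarrow> complex" where
  "bromwich a u = (THE v. \<forall>\<^sub>F s in at_top. bromwich_line a s u = v)"

definition bromwich_admissible :: "(complex \<times> gmono) list \<Rightarrow> bool" where
  "bromwich_admissible a \<longleftrightarrow> a \<in> MM_flat \<and>
     (\<exists>s0. (\<forall>s>s0. AE u in lborel. integrable lborel (bromwich_integrand a s u)) \<and>
           (\<forall>s>s0. \<forall>u. bromwich_line a s u = bromwich a u)) \<and>
     (\<forall>\<^sub>F N in sequentially.
        integrable lborel (\<lambda>u. bromwich a u * of_real (exp (real N * u))) \<and>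
        (LINT u|lborel. bromwich a u * of_real (exp (real N * u))) = continuation a (of_nat N))"

definition sel_plus_integrand :: "(complex \<times> gmono) list \<Rightarrow> nat \<Rightarrow> real \<Rightarrow> complex" where
  "sel_plus_integrand a N u = bromwich a u * of_real (exp (real N * u)) / of_real (1 - exp u)"

definition sel_plus_truncated :: "(complex \<times> gmono) list \<Rightarrow> nat \<Rightarrow> real \<Rightarrow> complex" where
  "sel_plus_truncated a N e = (LINT u:{u. \<bar>u\<bar> > e}|lborel. sel_plus_integrand a N u)"

definition sel_plus_exists :: "(complex \<times> gmono) list \<Rightarrow> nat \<Rightarrow> bool" where
  "sel_plus_exists a N \<longleftrightarrow>
     (\<forall>e>0. set_integrable lborel {u. \<bar>u\<bar> > e} (sel_plus_integrand a N)) \<and>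
     (\<exists>v. (sel_plus_truncated a N \<longlongrightarrow> v) (at_right 0))"

definition sel_plus :: "(complex \<times> gmono) list \<Rightarrow> nat \<Rightarrow> complex" where
  "sel_plus a N = Lim (at_right 0) (sel_plus_truncated a N)"

definition sel_minus_integrand :: "(complex \<times> gmono) list \<Rightarrow> nat \<Rightarrow> real \<Rightarrow> complex" where
  "sel_minus_integrand a N u = bromwich a u * of_real (exp (real N * u)) / of_real (1 + exp u)"

definition sel_minus_exists :: "(complex \<times> gmono) list \<Rightarrow> nat \<Rightarrow> bool" where
  "sel_minus_exists a N \<longleftrightarrow> integrable lborel (sel_minus_integrand a N)"

definition sel_minus :: "(complex \<times> gmono) list \<Rightarrow> nat \<Rightarrow> complex" where
  "sel_minus a N = (LINT u|lborel. sel_minus_integrand a N u)"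

definition admits_selector :: "(complex \<times> complex \<times> gmono) list \<Rightarrow> bool" where
  "admits_selector c \<longleftrightarrow>
     bromwich_admissible (phase_plus c) \<and> bromwich_admissible (phase_minus c) \<and>
     (\<forall>\<^sub>F N in sequentially. sel_plus_exists (phase_plus c) N \<and> sel_minus_exists (phase_minus c) N)"

definition selector :: "(complex \<times> complex \<times> gmono) list \<Rightarrow> nat \<Rightarrow> complex" where
  "selector c N = sel_plus (phase_plus c) N + (-1) ^ N * sel_minus (phase_minus c) N"


section \<open>Admissible sequences and finite parts\<close>

definition shift_nonresonant :: "(nat \<Rightarrow> complex) \<Rightarrow> bool" where
  "shift_nonresonant U \<longleftrightarrow> U \<longlonglongrightarrow> 0 \<or>
     (\<exists>e>0. \<exists>N0. \<forall>N\<ge>N0. norm (U N - U (Suc N)) \<ge> e * norm (U N))"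

definition represents_difference :: "(nat \<Rightarrow> complex) \<Rightarrow> (complex \<times> complex \<times> gmono) list \<Rightarrow> bool" where
  "represents_difference R c \<longleftrightarrow>
     c \<in> MM \<and> (\<forall>\<^sub>F N in sequentially. MM_germ c (real N) = R N - R (Suc N)) \<and>
     admits_selector c \<and> shift_nonresonant (selector c)"

definition M_admissible :: "(nat \<Rightarrow> complex) \<Rightarrow> bool" where
  "M_admissible R \<longleftrightarrow>
     (\<forall>\<^sub>F N in sequentially. R N - R (Suc N) = 0) \<or> (\<exists>c. represents_difference R c)"

text \<open>
  The finite part is first given as a relation, so that its existence and its independence of the
  representing expression \<open>c\<close> can be stated.
\<close>

definition has_finite_part :: "(nat \<Rightarrow> complex) \<Rightarrow> complex \<Rightarrow> bool" where
  "has_finite_part R v \<longleftrightarrow>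
     (if \<forall>\<^sub>F N in sequentially. R N - R (Suc N) = 0
      then \<forall>\<^sub>F N in sequentially. R N = v
      else \<exists>c. represents_difference R c \<and> (\<forall>\<^sub>F N in sequentially. R N - selector c N = v))"

definition finite_part :: "(nat \<Rightarrow> complex) \<Rightarrow> complex" where
  "finite_part R = (THE v. has_finite_part R v)"


section \<open>Recurrence presentations and \<open>C\<close>-summation\<close>

definition rec_presentation ::
    "nat \<Rightarrow> (nat \<Rightarrow> complex) \<Rightarrow> (nat \<Rightarrow> complex) \<Rightarrow> (nat \<Rightarrow> complex) \<Rightarrow> (nat \<Rightarrow> complex) \<Rightarrow> bool" where
  "rec_presentation n0 a b \<mu> c \<longleftrightarrow>
     (\<forall>n\<ge>n0. a n \<noteq> 0 \<and> b n \<noteq> 0) \<and>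
     (\<forall>k. c k = (-1) ^ k * \<mu> (n0 + k) * (\<Prod>j<k. b (n0 + j) / a (n0 + j + 1)))"

definition rec_solution ::
    "nat \<Rightarrow> (nat \<Rightarrow> complex) \<Rightarrow> (nat \<Rightarrow> complex) \<Rightarrow> (nat \<Rightarrow> complex) \<Rightarrow> (nat \<Rightarrow> complex) \<Rightarrow> bool" where
  "rec_solution n0 a b \<mu> I \<longleftrightarrow> (\<forall>n\<ge>n0. a n * I n + b n * I (n + 1) = \<mu> n)"

definition rec_prod :: "(nat \<Rightarrow> complex) \<Rightarrow> (nat \<Rightarrow> complex) \<Rightarrow> nat \<Rightarrow> nat \<Rightarrow> complex" where
  "rec_prod a b n n0 = (\<Prod>k=n0..<n. - (a k / b k))"

definition normalized_tail ::
    "nat \<Rightarrow> (nat \<Rightarrow> complex) \<Rightarrow> (nat \<Rightarrow> complex) \<Rightarrow> (nat \<Rightarrow> complex) \<Rightarrow> nat \<Rightarrow> complex" where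
  "normalized_tail n0 a b I N = a n0 * (I (n0 + N) / rec_prod a b (n0 + N) n0)"

definition C_value ::
    "nat \<Rightarrow> (nat \<Rightarrow> complex) \<Rightarrow> (nat \<Rightarrow> complex) \<Rightarrow> (nat \<Rightarrow> complex) \<Rightarrow> complex" where
  "C_value n0 a b I = a n0 * I n0 - finite_part (normalized_tail n0 a b I)"

definition admissible_presentation ::
    "nat \<Rightarrow> (nat \<Rightarrow> complex) \<Rightarrow> (nat \<Rightarrow> complex) \<Rightarrow> (nat \<Rightarrow> complex) \<Rightarrow> (nat \<Rightarrow> complex) \<Rightarrow>
     (nat \<Rightarrow> complex) \<Rightarrow> bool" where
  "admissible_presentation n0 a b \<mu> I c \<longleftrightarrow>
     rec_presentation n0 a b \<mu> c \<and> rec_solution n0 a b \<mu> I \<and>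
     M_admissible (normalized_tail n0 a b I)"

definition C_summable :: "(nat \<Rightarrow> complex) \<Rightarrow> bool" where
  "C_summable c \<longleftrightarrow> (\<exists>n0 a b \<mu> I. admissible_presentation n0 a b \<mu> I c)"

definition has_C_sum :: "(nat \<Rightarrow> complex) \<Rightarrow> complex \<Rightarrow> bool" where
  "has_C_sum c v \<longleftrightarrow>
     (\<exists>n0 a b \<mu> I. admissible_presentation n0 a b \<mu> I c \<and> v = C_value n0 a b I)"

definition C_sum :: "(nat \<Rightarrow> complex) \<Rightarrow> complex" where
  "C_sum c = (THE v. has_C_sum c v)"

definition shift_compatible :: "(nat \<Rightarrow> complex) \<Rightarrow> bool" where
  "shift_compatible R \<longleftrightarrow>
     M_admissible (\<lambda>N. R (Suc N)) \<and> finite_part R = finite_part (\<lambda>N. R (Suc N))"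

end

theory Submission
  imports Defs "HOL-Real_Asymp.Real_Asymp" "HOL-Complex_Analysis.Complex_Analysis"
begin

text \<open>
  Since \<open>R N - R (N + 1) = c N\<close>, every normalized tail is a constant minus the partial sums of the
  series, so two tails of the same series differ by a constant and everything reduces to the
  finite part being well defined and compatible with limits, constants and scalars.

  The selector solves \<open>U N - U (N + 1) = c N\<close>, because the kernels \<open>1 / (1 - exp u)\<close> and
  \<open>1 / (1 + exp u)\<close> invert the difference operator under the Laplace integral; hence \<open>R - U\<close> is
  eventually constant. The constant could only depend on the expression representing the
  difference. Any two growth monomials are either comparable by \<open>\<succ>\<^sub>g\<close> or equal as germs:
  the logarithm of their quotient is a linear combination of log-exp monomials tending to infinity
  (plus a convergent remainder coming from Stirling's formula), to which induction on the height
  applies, and non-resonance excludes a finite positive limit of a pure by a gamma-type monomial.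
  So the values at large integers determine the terms of the expression up to germ equality, and
  the identity theorem determines their continuations, the Bromwich transforms and the selector.

  For a convergent series, shift-nonresonance forces the selector to tend to \<open>0\<close>, so the finite
  part is the limit of the tail.
\<close>

section \<open>Stirling's formula up to an unspecified constant\<close>

text \<open>The functional equation makes \<open>Digamma (x + n)\<close> equal to
  \<open>Digamma x\<close> plus a sum of reciprocals, which the limit formula for the digamma
  function compares with \<open>ln n\<close>.\<close>

lemma Digamma_minus_ln_tendsto:
  fixes x :: real assumes "x > 0"
  shows "(\<lambda>n. Digamma (x + real n) - ln (real n)) \<longlonglongrightarrow> 0"
proof -
  have eq: "Digamma (x + real n) = Digamma x + (\<Sum>k<n. inverse (x + real k))" for n
  proof (induction n)
    case (Suc n)
    have "Digamma (x + real n + 1) = Digamma (x + real n) + 1 / (x + real n)"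
      by (rule Digamma_plus1) (use assms in auto)
    with Suc show ?case by (simp add: algebra_simps inverse_eq_divide)
  qed simp
  have "(\<lambda>n. ln (real n) - (\<Sum>k<n. inverse (x + real k))) \<longlonglongrightarrow> Digamma x"
    using Digamma_LIMSEQ[of x] assms by simp
  from tendsto_diff[OF tendsto_const[of "Digamma x"] this] show ?thesis
    by (simp add: eq algebra_simps)
qed

text \<open>Along \<open>x, x + 1, x + 2, ...\<close> the values increase to their limit 0. A sign
  on the whole half-line is thereby reduced to an inequality for one unit step.\<close>

lemma nonpos_if_shift_increasing:
  fixes d :: "real \<Rightarrow> real"
  assumes "\<And>y. y > 0 \<Longrightarrow> d y \<le> d (y + 1)" and "(\<lambda>n. d (x + real n)) \<longlonglongrightarrow> 0" and "x > 0"
  shows "d x \<le> 0"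
proof -
  have "incseq (\<lambda>n. d (x + real n))"
  proof (rule incseq_SucI)
    fix n show "d (x + real n) \<le> d (x + real (Suc n))"
      using assms(1)[of "x + real n"] \<open>x > 0\<close> by (simp add: algebra_simps)
  qed
  from incseq_le[OF this assms(2), of 0] show ?thesis by simp
qed

text \<open>\<open>ln_Gamma\<close> minus the growing terms of Stirling's formula; the constant of
  that formula is kept, as the limit at infinity.\<close>

definition stirling_rem :: "real \<Rightarrow> real" where
  "stirling_rem x = ln_Gamma x - (x - 1/2) * ln x + x"

definition stirling_rem_deriv :: "real \<Rightarrow> real" where
  "stirling_rem_deriv x = Digamma x - ln x + 1 / (2 * x)"

lemma stirling_rem_has_deriv:
  assumes "x > 0"
  shows "(stirling_rem has_real_derivative stirling_rem_deriv x) (at x)"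
  unfolding stirling_rem_def stirling_rem_deriv_def using assms
  by (auto intro!: derivative_eq_intros simp: field_simps)

lemma stirling_rem_deriv_tendsto:
  assumes "x > 0"
  shows "(\<lambda>n. stirling_rem_deriv (x + real n)) \<longlonglongrightarrow> 0"
proof -
  have "(\<lambda>n. ln (real n) - ln (x + real n) + 1 / (2 * (x + real n))) \<longlonglongrightarrow> 0"
    using assms by real_asymp
  from tendsto_add[OF Digamma_minus_ln_tendsto[OF assms] this] show ?thesis
    by (simp add: stirling_rem_deriv_def algebra_simps)
qed

text \<open>The increment is the error of the trapezoidal rule for the integral of
  \<open>1 / t\<close> over \<open>[x, x + 1]\<close>.\<close>

lemma stirling_rem_deriv_shift:
  assumes "x > 0"
  shows "stirling_rem_deriv (x + 1) - stirling_rem_deriv x =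
           (1 / x + 1 / (x + 1)) / 2 - (ln (x + 1) - ln x)"
proof -
  have "Digamma (x + 1) = Digamma x + 1 / x"
    using Digamma_plus1[of x] assms by simp
  moreover have "1 / x + 1 / (2 * (x + 1)) - 1 / (2 * x) = (1 / x + 1 / (x + 1)) / 2"
    using assms by (simp add: divide_simps) (simp add: algebra_simps)
  ultimately show ?thesis
    unfolding stirling_rem_deriv_def by linarith
qed

text \<open>The trapezoidal rule overestimates the integral of a convex function, so the unit
  increments are nonnegative.\<close>

lemma stirling_rem_deriv_nonpos:
  assumes "x > 0"
  shows "stirling_rem_deriv x \<le> 0"
proof (rule nonpos_if_shift_increasing[OF _ stirling_rem_deriv_tendsto])
  fix y :: real assume "y > 0"
  then show "stirling_rem_deriv y \<le> stirling_rem_deriv (y + 1)"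
    using stirling_rem_deriv_shift[of y] ln_inverse_approx_le[of y 1]
    unfolding inverse_eq_divide by linarith
qed (use assms in auto)

text \<open>This gives a lower bound that is integrable at infinity: the unit decrements of
  \<open>1 / x^2\<close> are at least as large as the trapezoidal errors.\<close>

lemma stirling_rem_deriv_ge:
  assumes "x > 0"
  shows "stirling_rem_deriv x \<ge> - (1 / x\<^sup>2)"
proof -
  define d where "d y = - stirling_rem_deriv y - 1 / y\<^sup>2" for y
  have "d x \<le> 0"
  proof (rule nonpos_if_shift_increasing[where d = d])
    fix y :: real assume y: "y > 0"
    \<comment> \<open>Midpoint rule: \<open>2 / (2 * y + 1)\<close> is the value of
      \<open>1 / t\<close> at the midpoint of the interval and, by convexity, bounds the integral
      from below.\<close>
    have "(1 / y + 1 / (y + 1)) / 2 - (ln (y + 1) - ln y) \<le> (1 / y + 1 / (y + 1)) / 2 - 2 / (2 * y + 1)"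
      using ln_inverse_approx_ge[of y "y + 1"] y by simp
    also have "\<dots> = 1 / (2 * (y * (y + 1)) * (2 * y + 1))"
      using y by (simp add: divide_simps) (simp add: algebra_simps power2_eq_square)?
    also have "\<dots> \<le> (2 * y + 1) / (y * (y + 1))\<^sup>2"
    proof -
      have "y * (y + 1) \<le> 2 * (2 * y + 1) * (2 * y + 1)"
        using y by (simp add: algebra_simps power2_eq_square)
      then have "y * (y + 1) * (y * (y + 1)) \<le> 2 * (2 * y + 1) * (2 * y + 1) * (y * (y + 1))"
        using y by (intro mult_right_mono) auto
      then show ?thesis using y
        by (simp add: divide_simps power2_eq_square) (simp add: algebra_simps)
    qed
    also have "\<dots> = 1 / y\<^sup>2 - 1 / (y + 1)\<^sup>2"
      using y by (simp add: divide_simps power2_eq_square) (simp add: algebra_simps)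
    finally show "d y \<le> d (y + 1)"
      using stirling_rem_deriv_shift[OF y] by (simp add: d_def)
  next
    have "(\<lambda>n. 1 / (x + real n)\<^sup>2) \<longlonglongrightarrow> 0" by real_asymp
    from tendsto_diff[OF tendsto_minus[OF stirling_rem_deriv_tendsto[OF assms]] this]
    show "(\<lambda>n. d (x + real n)) \<longlonglongrightarrow> 0" by (simp add: d_def)
  qed (use assms in auto)
  then show ?thesis by (simp add: d_def)
qed

text \<open>The remainder decreases, and subtracting \<open>1 / x\<close> makes it increase from 1
  on, which bounds it from below; hence it tends to its infimum there.\<close>

lemma stirling_rem_converges: "\<exists>L. (stirling_rem \<longlongrightarrow> L) at_top"
proof -
  have decr: "stirling_rem y \<le> stirling_rem x" if "0 < x" "x \<le> y" for x y
  proof (rule DERIV_nonpos_imp_nonincreasing[OF that(2)])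
    fix z assume "x \<le> z" "z \<le> y"
    then show "\<exists>y. (stirling_rem has_real_derivative y) (at z) \<and> y \<le> 0"
      using stirling_rem_has_deriv[of z] stirling_rem_deriv_nonpos[of z] that by auto
  qed
  have bound: "stirling_rem x \<ge> stirling_rem 1 - 1" if "x \<ge> 1" for x
  proof -
    have "stirling_rem 1 - 1 / 1 \<le> stirling_rem x - 1 / x"
    proof (rule DERIV_nonneg_imp_nondecreasing[OF that])
      fix z :: real assume z: "1 \<le> z" "z \<le> x"
      have "((\<lambda>z. stirling_rem z - 1 / z) has_real_derivative (stirling_rem_deriv z + 1 / z\<^sup>2)) (at z)"
        using z by (auto intro!: derivative_eq_intros stirling_rem_has_deriv simp: power2_eq_square)
      then show "\<exists>y. ((\<lambda>z. stirling_rem z - 1 / z) has_real_derivative y) (at z) \<and> 0 \<le> y"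
        using stirling_rem_deriv_ge[of z] z by (intro exI[of _ "stirling_rem_deriv z + 1 / z\<^sup>2"]) auto
    qed
    moreover have "1 / x \<ge> 0" using that by simp
    ultimately show ?thesis by linarith
  qed
  have bdd: "bdd_below (stirling_rem ` {1..})"
    using bound by (auto intro!: bdd_belowI2[of _ "stirling_rem 1 - 1"])
  have "(stirling_rem \<longlongrightarrow> Inf (stirling_rem ` {1..})) at_top"
  proof (rule decreasing_tendsto)
    show "\<forall>\<^sub>F x in at_top. Inf (stirling_rem ` {1..}) \<le> stirling_rem x"
      using eventually_ge_at_top[of 1] by eventually_elim (auto intro!: cInf_lower bdd)
  next
    fix u assume "Inf (stirling_rem ` {1..}) < u"
    then obtain x where x: "x \<ge> 1" "stirling_rem x < u"
      by (subst (asm) cInf_less_iff) (auto simp: bdd)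
    show "\<forall>\<^sub>F x in at_top. stirling_rem x < u"
      using eventually_ge_at_top[of x] by eventually_elim (use x decr[of x] in force)
  qed
  then show ?thesis ..
qed

text \<open>Apart from a convergent term, the logarithm becomes a linear combination of
  \<open>x * ln x\<close>, \<open>x\<close> and \<open>ln x\<close>, which are germs of log-exp
  monomials; this puts gamma-type germs on the same scale as pure ones. The extra factor in
  \<open>Gamma (y + 1) = y * Gamma y\<close> turns \<open>- 1/2 * ln y\<close> into
  \<open>1/2 * ln y\<close>.\<close>

lemma ln_Gamma_affine_asymp:
  fixes \<kappa> :: real
  assumes "\<kappa> > 0"
  shows "\<exists>L. ((\<lambda>x. ln (Gamma (\<kappa> * x + 1)) -
     (\<kappa> * (x * ln x) + \<kappa> * (ln \<kappa> - 1) * x + 1/2 * ln x)) \<longlongrightarrow> L) at_top"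
proof -
  obtain L where L: "(stirling_rem \<longlongrightarrow> L) at_top" using stirling_rem_converges ..
  have "filterlim (\<lambda>x::real. \<kappa> * x) at_top at_top"
    using assms by (rule filterlim_tendsto_pos_mult_at_top[where f = "\<lambda>_. \<kappa>" and g = "\<lambda>x. x", OF tendsto_const _ filterlim_ident])
  with L have "((\<lambda>x. stirling_rem (\<kappa> * x)) \<longlongrightarrow> L) at_top" by (rule filterlim_compose)
  then have "((\<lambda>x. stirling_rem (\<kappa> * x) + 1/2 * ln \<kappa>) \<longlongrightarrow> L + 1/2 * ln \<kappa>) at_top"
    by (intro tendsto_intros)
  moreover have "\<forall>\<^sub>F x in at_top. stirling_rem (\<kappa> * x) + 1/2 * ln \<kappa> = ln (Gamma (\<kappa> * x + 1)) -
     (\<kappa> * (x * ln x) + \<kappa> * (ln \<kappa> - 1) * x + 1/2 * ln x)"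
    using eventually_gt_at_top[of 0]
  proof eventually_elim
    case (elim x)
    have pos: "\<kappa> * x > 0" and nz: "\<kappa> \<noteq> 0" "x \<noteq> 0" using elim assms by simp_all
    have "Gamma (\<kappa> * x + 1) = (\<kappa> * x) * Gamma (\<kappa> * x)"
      by (rule Gamma_plus1) (use pos in auto)
    then have "ln (Gamma (\<kappa> * x + 1)) = ln (\<kappa> * x) + ln_Gamma (\<kappa> * x)"
      using pos nz by (simp add: ln_mult Gamma_real_pos Gamma_real_pos_exp[OF pos])
    moreover have "ln (\<kappa> * x) = ln \<kappa> + ln x" using elim assms by (simp add: ln_mult)
    ultimately show ?case by (simp add: stirling_rem_def field_simps)
  qed
  ultimately show ?thesis by (intro exI) (rule Lim_transform_eventually)
qed

section \<open>Linear combinations of pairwise comparable functions\<close>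

lemma dominates_trans:
  assumes "f \<succ>\<^sub>g g" "g \<succ>\<^sub>g h" "\<forall>\<^sub>F x in at_top. g x \<noteq> 0"
  shows "f \<succ>\<^sub>g h"
proof -
  have "((\<lambda>x. (g x / f x) * (h x / g x)) \<longlongrightarrow> 0 * 0) at_top"
    using assms(1,2) unfolding dominates_def by (rule tendsto_mult)
  moreover have "\<forall>\<^sub>F x in at_top. (g x / f x) * (h x / g x) = h x / f x"
    using assms(3) by eventually_elim simp
  ultimately show ?thesis
    unfolding dominates_def by (simp add: tendsto_cong)
qed

lemma germ_eq_sym: "germ_eq f g \<Longrightarrow> germ_eq g f"
  by (simp add: germ_eq_def eq_commute)

text \<open>An asymptotic scale. Quotients with a finite nonzero limit are excluded unless the two
  functions have the same germ.\<close>

definition comparable_scale :: "(real \<Rightarrow> real) set \<Rightarrow> bool" where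
  "comparable_scale F \<longleftrightarrow> (\<forall>f\<in>F. filterlim f at_top at_top) \<and>
     (\<forall>f\<in>F. \<forall>g\<in>F. f \<succ>\<^sub>g g \<or> g \<succ>\<^sub>g f \<or> germ_eq f g)"

definition combo :: "(real \<times> (real \<Rightarrow> real)) list \<Rightarrow> real \<Rightarrow> real" where
  "combo xs x = (\<Sum>(c, f)\<leftarrow>xs. c * f x)"

lemma combo_simps [simp]:
  "combo [] x = 0"
  "combo ((c, f) # xs) x = c * f x + combo xs x"
  "combo (xs @ ys) x = combo xs x + combo ys x"
  by (simp_all add: combo_def)

definition scale_by :: "real \<Rightarrow> (real \<times> (real \<Rightarrow> real)) list \<Rightarrow> (real \<times> (real \<Rightarrow> real)) list" where
  "scale_by d = map (\<lambda>(c, f). (d * c, f))"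

lemma combo_scale_by [simp]: "combo (scale_by d xs) x = d * combo xs x"
  by (induction xs) (auto simp: scale_by_def algebra_simps)

lemma functions_scale_by [simp]: "snd ` set (scale_by d xs) = snd ` set xs"
  by (force simp: scale_by_def image_iff)

definition strictly_decreasing :: "(real \<times> (real \<Rightarrow> real)) list \<Rightarrow> bool" where
  "strictly_decreasing ys \<longleftrightarrow> (\<forall>c\<in>fst ` set ys. c \<noteq> 0) \<and> sorted_wrt (\<lambda>f g. f \<succ>\<^sub>g g) (map snd ys)"

lemma strictly_decreasing_Cons:
  "strictly_decreasing ((c, f) # ys) \<longleftrightarrow>
     c \<noteq> 0 \<and> (\<forall>g\<in>snd ` set ys. f \<succ>\<^sub>g g) \<and> strictly_decreasing ys"
  by (auto simp: strictly_decreasing_def)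

text \<open>One step of insertion sort by growth. A germ-equal entry absorbs the new coefficient and
  disappears if the sum is zero. The bound on the functions of \<open>zs\<close> lets a head that
  dominates both \<open>f\<close> and the rest be put back in front.\<close>

lemma combo_insert:
  assumes "comparable_scale F" "f \<in> F" "snd ` set ys \<subseteq> F" "strictly_decreasing ys" "c \<noteq> 0"
  shows "\<exists>zs. strictly_decreasing zs \<and> snd ` set zs \<subseteq> insert f (snd ` set ys) \<and>
           germ_eq (combo zs) (\<lambda>x. c * f x + combo ys x)"
  using assms(3,4)
proof (induction ys)
  case Nil
  then show ?case using \<open>c \<noteq> 0\<close>
    by (intro exI[of _ "[(c, f)]"]) (auto simp: strictly_decreasing_def germ_eq_def)
next
  case (Cons y ys)
  obtain d g where y: "y = (d, g)" by fastforce
  have g: "g \<in> F" using Cons.prems y by auto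
  have nz: "\<forall>\<^sub>F x in at_top. g x \<noteq> 0"
  proof -
    have "filterlim g at_top at_top" using assms(1) g by (auto simp: comparable_scale_def)
    then have "\<forall>\<^sub>F x in at_top. g x > 0" by (simp add: filterlim_at_top_dense)
    then show ?thesis by eventually_elim simp
  qed
  consider "f \<succ>\<^sub>g g" | "g \<succ>\<^sub>g f" | "germ_eq f g"
    using assms(1,2) g by (auto simp: comparable_scale_def)
  then show ?case
  proof cases
    case 1
    then have "\<forall>h\<in>snd ` set (y # ys). f \<succ>\<^sub>g h"
      using Cons.prems(2) y nz by (auto simp: strictly_decreasing_Cons intro: dominates_trans)
    then show ?thesis
      using \<open>c \<noteq> 0\<close> Cons.prems(2) y
      by (intro exI[of _ "(c, f) # y # ys"]) (auto simp: strictly_decreasing_Cons germ_eq_def)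
  next
    case 2
    from Cons.prems y have "snd ` set ys \<subseteq> F" "strictly_decreasing ys"
      by (auto simp: strictly_decreasing_Cons)
    from Cons.IH[OF this] obtain zs where zs: "strictly_decreasing zs"
      "snd ` set zs \<subseteq> insert f (snd ` set ys)" "germ_eq (combo zs) (\<lambda>x. c * f x + combo ys x)"
      by blast
    have "\<forall>h\<in>snd ` set zs. g \<succ>\<^sub>g h"
    proof
      fix h assume "h \<in> snd ` set zs"
      then have "h = f \<or> h \<in> snd ` set ys" using zs(2) by blast
      then show "g \<succ>\<^sub>g h" using Cons.prems(2) y 2 by (auto simp: strictly_decreasing_Cons)
    qed
    then have "strictly_decreasing (y # zs)"
      using zs(1) Cons.prems(2) y by (simp add: strictly_decreasing_Cons)
    moreover have "snd ` set (y # zs) \<subseteq> insert f (snd ` set (y # ys))"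
      using zs(2) by auto
    moreover have "germ_eq (combo (y # zs)) (\<lambda>x. c * f x + combo (y # ys) x)"
      using zs(3) unfolding germ_eq_def by eventually_elim (simp add: y)
    ultimately show ?thesis by blast
  next
    case 3
    show ?thesis
    proof (cases "c + d = 0")
      case True
      then have "d = - c" by simp
      have "germ_eq (combo ys) (\<lambda>x. c * f x + combo (y # ys) x)"
        using 3 unfolding germ_eq_def by eventually_elim (simp add: y \<open>d = - c\<close>)
      moreover have "strictly_decreasing ys"
        using Cons.prems y by (simp add: strictly_decreasing_Cons)
      moreover have "snd ` set ys \<subseteq> insert f (snd ` set (y # ys))" by auto
      ultimately show ?thesis by blast
    next
      case False
      have "germ_eq (combo ((c + d, g) # ys)) (\<lambda>x. c * f x + combo (y # ys) x)"
        using 3 unfolding germ_eq_def by eventually_elim (simp add: y algebra_simps)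
      moreover have "strictly_decreasing ((c + d, g) # ys)"
        using Cons.prems y False by (simp add: strictly_decreasing_Cons)
      moreover have "snd ` set ((c + d, g) # ys) \<subseteq> insert f (snd ` set (y # ys))"
        by (auto simp: y)
      ultimately show ?thesis by blast
    qed
  qed
qed

lemma combo_normal_form:
  assumes "comparable_scale F" "snd ` set xs \<subseteq> F"
  shows "\<exists>ys. strictly_decreasing ys \<and> snd ` set ys \<subseteq> F \<and> germ_eq (combo ys) (combo xs)"
  using assms(2)
proof (induction xs)
  case Nil
  then show ?case by (intro exI[of _ "[]"]) (auto simp: strictly_decreasing_def germ_eq_def)
next
  case (Cons x xs)
  obtain c f where x: "x = (c, f)" by fastforce
  from Cons obtain ys where ys: "strictly_decreasing ys" "snd ` set ys \<subseteq> F"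
    "germ_eq (combo ys) (combo xs)" by auto
  show ?case
  proof (cases "c = 0")
    case True
    then have "combo (x # xs) = combo xs" by (simp add: x fun_eq_iff)
    then show ?thesis using ys by metis
  next
    case False
    have "f \<in> F" using Cons.prems x by auto
    from combo_insert[OF assms(1) this ys(2,1) False] obtain zs where zs:
      "strictly_decreasing zs" "snd ` set zs \<subseteq> insert f (snd ` set ys)"
      "germ_eq (combo zs) (\<lambda>x. c * f x + combo ys x)" by blast
    have "germ_eq (combo zs) (combo (x # xs))"
      using zs(3) ys(3) unfolding germ_eq_def by eventually_elim (simp add: x)
    moreover have "snd ` set zs \<subseteq> F" using zs(2) ys(2) \<open>f \<in> F\<close> by blast
    ultimately show ?thesis using zs(1) by metis
  qed
qed

lemma combo_dominated:
  assumes "\<forall>g\<in>snd ` set ys. f \<succ>\<^sub>g g"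
  shows "f \<succ>\<^sub>g combo ys"
  using assms
proof (induction ys)
  case (Cons y ys)
  obtain d g where y: "y = (d, g)" by fastforce
  from Cons y have "f \<succ>\<^sub>g combo ys" "f \<succ>\<^sub>g g" by auto
  then have "((\<lambda>x. d * (g x / f x) + combo ys x / f x) \<longlongrightarrow> d * 0 + 0) at_top"
    unfolding dominates_def by (intro tendsto_intros)
  then show ?case by (simp add: y dominates_def add_divide_distrib)
qed (simp add: dominates_def)

text \<open>Factoring out the leading function of the normal form leaves a factor that tends to its
  nonzero coefficient, and every function of the scale tends to infinity. An empty normal form gives
  the zero germ.\<close>

lemma combo_trichotomy:
  assumes "comparable_scale F" "snd ` set xs \<subseteq> F"
  shows "filterlim (combo xs) at_top at_top \<or> filterlim (combo xs) at_bot at_top \<or>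
         germ_eq (combo xs) (\<lambda>_. 0)"
proof -
  from combo_normal_form[OF assms] obtain ys where ys: "strictly_decreasing ys" "snd ` set ys \<subseteq> F"
    "germ_eq (combo ys) (combo xs)" by blast
  show ?thesis
  proof (cases ys)
    case Nil
    then have "combo ys = (\<lambda>_. 0)" by (simp add: fun_eq_iff)
    then show ?thesis using germ_eq_sym[OF ys(3)] by simp
  next
    case (Cons y zs)
    obtain c f where y: "y = (c, f)" by fastforce
    have f: "filterlim f at_top at_top" using ys(2) assms(1) Cons y by (auto simp: comparable_scale_def)
    have nz: "\<forall>\<^sub>F x in at_top. f x > 0" using f by (simp add: filterlim_at_top_dense)
    have "c \<noteq> 0" "f \<succ>\<^sub>g combo zs"
      using ys(1) Cons y by (auto simp: strictly_decreasing_Cons intro: combo_dominated)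
    then have "((\<lambda>x. c + combo zs x / f x) \<longlongrightarrow> c + 0) at_top"
      unfolding dominates_def by (intro tendsto_intros)
    then have lim: "((\<lambda>x. c + combo zs x / f x) \<longlongrightarrow> c) at_top" by simp
    have eq: "\<forall>\<^sub>F x in at_top. (c + combo zs x / f x) * f x = combo xs x"
      using nz ys(3) unfolding germ_eq_def
      by eventually_elim (simp add: Cons y field_simps)
    show ?thesis
    proof (cases "c > 0")
      case True
      from filterlim_tendsto_pos_mult_at_top[OF lim this f] eq
      have "filterlim (combo xs) at_top at_top" by (simp add: filterlim_cong)
      then show ?thesis ..
    next
      case False
      with \<open>c \<noteq> 0\<close> have "c < 0" by simp
      from filterlim_tendsto_neg_mult_at_bot[OF lim this f] eq
      have "filterlim (combo xs) at_bot at_top" by (simp add: filterlim_cong)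
      then show ?thesis by blast
    qed
  qed
qed

section \<open>Comparability of log-exp monomials\<close>

lemma dominates_cong:
  assumes "germ_eq f f'" "germ_eq g g'"
  shows "f \<succ>\<^sub>g g \<longleftrightarrow> f' \<succ>\<^sub>g g'"
  unfolding dominates_def using assms unfolding germ_eq_def
  by (intro tendsto_cong) (auto elim: eventually_elim2)

lemma dominates_if_ln_diff:
  assumes "\<forall>\<^sub>F x in at_top. f x > 0" "\<forall>\<^sub>F x in at_top. g x > 0"
    and "filterlim (\<lambda>x. ln (f x) - ln (g x)) at_top at_top"
  shows "f \<succ>\<^sub>g g"
proof -
  have "filterlim (\<lambda>x. - (ln (f x) - ln (g x))) at_bot at_top"
    using assms(3) by (simp add: filterlim_uminus_at_top)
  then have "((\<lambda>x. exp (- (ln (f x) - ln (g x)))) \<longlongrightarrow> 0) at_top"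
    by (rule filterlim_compose[OF exp_at_bot])
  moreover have "\<forall>\<^sub>F x in at_top. exp (- (ln (f x) - ln (g x))) = g x / f x"
    using assms(1,2) by eventually_elim (simp add: exp_diff)
  ultimately show ?thesis
    unfolding dominates_def by (rule Lim_transform_eventually)
qed

section \<open>Iterated logarithms as an asymptotic scale\<close>

lemma iter_log_0 [simp]: "iter_log 0 x = x"
  by (simp add: iter_log_def)

lemma iter_log_Suc [simp]: "iter_log (Suc j) x = ln (iter_log j x)"
  by (simp add: iter_log_def)

lemma iter_log_at_top: "filterlim (iter_log j :: real \<Rightarrow> real) at_top at_top"
proof (induction j)
  case (Suc j)
  from filterlim_compose[OF ln_at_top Suc] show ?case by simp
qed (simp add: filterlim_ident)

lemma eventually_iter_log_gt: "\<forall>\<^sub>F x in at_top. iter_log j x > (c::real)"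
  using iter_log_at_top[of j] by (simp add: filterlim_at_top_dense)

lemma eventually_iter_log_pos: "\<forall>\<^sub>F x in at_top. \<forall>j\<le>n. iter_log j x > (0::real)"
proof -
  have "\<forall>\<^sub>F x in at_top. \<forall>j\<in>{..n}. iter_log j x > (0::real)"
    by (intro eventually_ball_finite ballI eventually_iter_log_gt) auto
  then show ?thesis by eventually_elim auto
qed

lemma iter_log_dominates:
  assumes "j < k"
  shows "(iter_log j :: real \<Rightarrow> real) \<succ>\<^sub>g iter_log k"
  using assms
proof (induction rule: less_Suc_induct)
  case (1 j)
  from filterlim_compose[OF ln_x_over_x_tendsto_0 iter_log_at_top[of j]]
  show ?case by (simp add: dominates_def)
next
  case (2 i j k)
  have "\<forall>\<^sub>F x in at_top. iter_log j x \<noteq> (0::real)"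
    using eventually_iter_log_gt[of 0 j] by eventually_elim simp
  with 2 show ?case by (blast intro: dominates_trans)
qed

lemma comparable_scale_iter_log: "comparable_scale (range iter_log)"
proof -
  have "iter_log j \<succ>\<^sub>g iter_log k \<or> iter_log k \<succ>\<^sub>g iter_log j \<or> germ_eq (iter_log j) (iter_log k)"
    for j k
    using iter_log_dominates by (cases j k rule: linorder_cases) (auto simp: germ_eq_def)
  then show ?thesis by (auto simp: comparable_scale_def iter_log_at_top)
qed

section \<open>Logarithms of log-exp expressions\<close>

lemma eventually_lexp_eval_pos: "\<forall>\<^sub>F x in at_top. lexp_eval L x > (0::real)"
proof (cases L)
  case (LExp \<Phi> \<alpha>)
  show ?thesis
    using eventually_iter_log_pos[of "length \<alpha>"]
  proof eventually_elim
    case (elim x)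
    have "iter_log j x powr of_real (\<alpha> ! j) > (0::real)" if "j < length \<alpha>" for j
      using elim[rule_format, of j] that by simp
    then have "(\<Prod>j<length \<alpha>. iter_log j x powr of_real (\<alpha> ! j)) > (0::real)"
      by (intro prod_pos) simp
    then show ?case unfolding LExp lexp_eval.simps by (intro mult_pos_pos exp_gt_zero)
  qed
qed

text \<open>Taking logarithms turns quotients of expressions into differences of linear
  combinations, so that \<open>combo_trichotomy\<close> applies. A power of
  \<open>iter_log j\<close> contributes a multiple of the next iterated logarithm.\<close>

definition log_terms :: "lexp \<Rightarrow> (real \<times> (real \<Rightarrow> real)) list" where
  "log_terms L = (case L of LExp \<Phi> \<alpha> \<Rightarrow>
     map (\<lambda>(c, M). (c, lexp_eval M)) \<Phi> @ map (\<lambda>j. (\<alpha> ! j, iter_log (Suc j))) [0..<length \<alpha>])"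

lemma ln_lexp_eval: "germ_eq (\<lambda>x. ln (lexp_eval L x)) (combo (log_terms L))"
proof (cases L)
  case (LExp \<Phi> \<alpha>)
  show ?thesis
    using eventually_iter_log_pos[of "length \<alpha>"] unfolding germ_eq_def
  proof eventually_elim
    case (elim x)
    let ?P = "\<Prod>j<length \<alpha>. iter_log j x powr of_real (\<alpha> ! j)"
    have pos: "iter_log j x powr of_real (\<alpha> ! j) > (0::real)" if "j < length \<alpha>" for j
      using elim[rule_format, of j] that by simp
    have "ln ?P = (\<Sum>j<length \<alpha>. ln (iter_log j x powr of_real (\<alpha> ! j)))"
      using pos by (intro ln_prod) auto
    also have "\<dots> = (\<Sum>j<length \<alpha>. \<alpha> ! j * ln (iter_log j x))"
      by (intro sum.cong) (auto simp: ln_powr)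
    also have "\<dots> = combo (map (\<lambda>j. (\<alpha> ! j, iter_log (Suc j))) [0..<length \<alpha>]) x"
      by (simp add: combo_def o_def interv_sum_list_conv_sum_set_nat atLeast0LessThan)
    finally have P: "ln ?P = \<dots>" .
    have \<Phi>: "(\<Sum>(c, M)\<leftarrow>\<Phi>. of_real c * lexp_eval M x) = combo (map (\<lambda>(c, M). (c, lexp_eval M)) \<Phi>) x"
      by (induction \<Phi>) auto
    have "?P > 0" using pos by (intro prod_pos) auto
    then have "ln (lexp_eval L x) = (\<Sum>(c, M)\<leftarrow>\<Phi>. of_real c * lexp_eval M x) + ln ?P"
      unfolding LExp lexp_eval.simps by (subst ln_mult_pos) (auto simp del: of_real_eq_id)
    then show ?case unfolding P \<Phi> by (simp add: LExp log_terms_def)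
  qed
qed

text \<open>
  Closed under germ equality: as functions, \<^const>\<open>iter_log\<close> and its expression differ at small
  arguments, where \<^const>\<open>ln\<close> and \<^const>\<open>powr\<close> take junk values.
\<close>

definition expression_scale :: "lexp set \<Rightarrow> (real \<Rightarrow> real) set" where
  "expression_scale A = {f. (\<exists>M\<in>A. germ_eq (lexp_eval M) f) \<and> filterlim f at_top at_top}"

text \<open>The difference of the logarithms tends to plus or minus infinity or vanishes eventually;
  exponentiating gives domination in one direction, in the other, or equality of germs.\<close>

lemma lexp_eval_trichotomy_if_scale:
  assumes "comparable_scale F" "snd ` set (log_terms L) \<subseteq> F" "snd ` set (log_terms L') \<subseteq> F"
  shows "lexp_eval L \<succ>\<^sub>g lexp_eval L' \<or> lexp_eval L' \<succ>\<^sub>g lexp_eval L \<or>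
         germ_eq (lexp_eval L) (lexp_eval L')"
proof -
  let ?xs = "log_terms L @ scale_by (-1) (log_terms L')"
  have eq: "\<forall>\<^sub>F x in at_top. combo ?xs x = ln (lexp_eval L x) - ln (lexp_eval L' x)"
    using ln_lexp_eval[of L] ln_lexp_eval[of L'] unfolding germ_eq_def by eventually_elim simp
  have "snd ` set ?xs = snd ` set (log_terms L) \<union> snd ` set (log_terms L')"
    by (simp only: set_append image_Un functions_scale_by)
  then have "snd ` set ?xs \<subseteq> F" using assms by blast
  from combo_trichotomy[OF assms(1) this]
  consider "filterlim (combo ?xs) at_top at_top" | "filterlim (combo ?xs) at_bot at_top"
    | "germ_eq (combo ?xs) (\<lambda>_. 0)" by blast
  then show ?thesis
  proof cases
    case 1
    then have "filterlim (\<lambda>x::real. ln (lexp_eval L x) - ln (lexp_eval L' x)) at_top at_top"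
      by (rule filterlim_cong[OF refl refl eq, THEN iffD1])
    then show ?thesis
      using dominates_if_ln_diff[OF eventually_lexp_eval_pos eventually_lexp_eval_pos] by blast
  next
    case 2
    then have "filterlim (\<lambda>x::real. ln (lexp_eval L x) - ln (lexp_eval L' x)) at_bot at_top"
      by (rule filterlim_cong[OF refl refl eq, THEN iffD1])
    then have "filterlim (\<lambda>x::real. ln (lexp_eval L' x) - ln (lexp_eval L x)) at_top at_top"
      by (simp add: filterlim_uminus_at_top)
    then show ?thesis
      using dominates_if_ln_diff[OF eventually_lexp_eval_pos eventually_lexp_eval_pos] by blast
  next
    case 3
    have "germ_eq (lexp_eval L) (lexp_eval L')"
      using 3 eq eventually_lexp_eval_pos[of L] eventually_lexp_eval_pos[of L']
      unfolding germ_eq_def by eventually_elim (simp add: ln_inj_iff)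
    then show ?thesis by blast
  qed
qed

section \<open>Comparison of log-exp monomials by induction on the height\<close>

definition iter_log_expr :: "nat \<Rightarrow> lexp" where
  "iter_log_expr j = LExp [] (replicate j 0 @ [1])"

lemma iter_log_expr_eval: "germ_eq (lexp_eval (iter_log_expr j)) (iter_log j)"
  unfolding germ_eq_def using eventually_iter_log_pos[of j]
proof eventually_elim
  case (elim x)
  \<comment> \<open>\<open>powr 0\<close> has the value 1 only at a nonzero base, hence the
    restriction to large \<open>x\<close>.\<close>
  have "(\<Prod>i<j. iter_log i x powr ((replicate j 0 @ [1]) ! i)) = (1::real)"
  proof (rule prod.neutral, rule ballI)
    fix i assume "i \<in> {..<j}"
    then show "iter_log i x powr ((replicate j 0 @ [1]) ! i) = 1"
      using elim[rule_format, of i] by (simp add: nth_append)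
  qed
  then show ?case
    using elim[rule_format, of j] by (simp add: iter_log_expr_def nth_append)
qed

lemma logexp_upto_mono: "h \<le> h' \<Longrightarrow> logexp_upto h \<subseteq> logexp_upto h'"
  by (rule lift_Suc_mono_le[of logexp_upto]) auto

text \<open>Iterated logarithms of positive index are barred from reduced exponents but come back as
  logarithms of the power factors, so the scale at every height has to contain them.\<close>

lemma iter_log_in_expression_scale: "iter_log j \<in> expression_scale (logexp_upto h)"
proof -
  have "iter_log_expr j \<in> logexp_upto 0" by (auto simp: iter_log_expr_def)
  then have "iter_log_expr j \<in> logexp_upto h" using logexp_upto_mono[of 0 h] by blast
  then show ?thesis using iter_log_expr_eval iter_log_at_top by (auto simp: expression_scale_def)
qed

lemma reduced_exponent_mono: "reduced_exponent A \<Phi> \<Longrightarrow> A \<subseteq> B \<Longrightarrow> reduced_exponent B \<Phi>"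
  unfolding reduced_exponent_def by blast

text \<open>Since the classes are cumulative, an expression may already occur at a lower height; the
  induction descends to that height and monotonicity carries the result back up. At height 0 the
  exponent is empty.\<close>

lemma reduced_exponent_of_logexp_upto_Suc:
  "LExp \<Phi> \<alpha> \<in> logexp_upto (Suc h) \<Longrightarrow> reduced_exponent (logexp_upto h) \<Phi>"
proof (induction h)
  case 0
  have "reduced_exponent (logexp_upto 0) []" by (simp add: reduced_exponent_def)
  with 0 show ?case by auto
next
  case (Suc h)
  from Suc.prems have "LExp \<Phi> \<alpha> \<in> logexp_upto (Suc h) \<or> reduced_exponent (logexp_upto (Suc h)) \<Phi>"
    by (subst (asm) logexp_upto.simps(2)) blast
  then show ?case
  proof
    assume "LExp \<Phi> \<alpha> \<in> logexp_upto (Suc h)"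
    then have "reduced_exponent (logexp_upto h) \<Phi>" by (rule Suc.IH)
    then show ?thesis by (rule reduced_exponent_mono) (rule logexp_upto_mono, simp)
  qed
qed

text \<open>Taking logarithms lowers the height by one, which drives the induction below.\<close>

lemma log_terms_in_scale:
  assumes "L \<in> logexp_upto (Suc h)"
  shows "snd ` set (log_terms L) \<subseteq> expression_scale (logexp_upto h)"
proof (cases L)
  case (LExp \<Phi> \<alpha>)
  have red: "reduced_exponent (logexp_upto h) \<Phi>"
    using assms unfolding LExp by (rule reduced_exponent_of_logexp_upto_Suc)
  have "lexp_eval M \<in> expression_scale (logexp_upto h)" if "(c, M) \<in> set \<Phi>" for c M
  proof -
    from that red have "M \<in> logexp_upto h" "filterlim (lexp_eval M :: real \<Rightarrow> real) at_top at_top"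
      unfolding reduced_exponent_def by blast+
    moreover have "germ_eq (lexp_eval M) (lexp_eval M)" by (simp add: germ_eq_def)
    ultimately show ?thesis unfolding expression_scale_def by blast
  qed
  then show ?thesis
    using iter_log_in_expression_scale[of "Suc _" h]
    by (auto simp: LExp log_terms_def simp del: iter_log_Suc)
qed

lemma comparable_expression_scale:
  assumes "\<And>L L'. L \<in> A \<Longrightarrow> L' \<in> A \<Longrightarrow> lexp_eval L \<succ>\<^sub>g lexp_eval L' \<or>
     lexp_eval L' \<succ>\<^sub>g lexp_eval L \<or> germ_eq (lexp_eval L) (lexp_eval L')"
  shows "comparable_scale (expression_scale A)"
  unfolding comparable_scale_def
proof (intro conjI ballI)
  fix f g assume "f \<in> expression_scale A" "g \<in> expression_scale A"
  then obtain L L' where L: "L \<in> A" "L' \<in> A" "germ_eq (lexp_eval L) f" "germ_eq (lexp_eval L') g"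
    by (auto simp: expression_scale_def)
  have "germ_eq f g" if "germ_eq (lexp_eval L) (lexp_eval L')"
    using that L(3,4) unfolding germ_eq_def by eventually_elim simp
  then show "f \<succ>\<^sub>g g \<or> g \<succ>\<^sub>g f \<or> germ_eq f g"
    using assms[OF L(1,2)] dominates_cong[OF L(3,4)] dominates_cong[OF L(4,3)] by blast
qed (simp add: expression_scale_def)

text \<open>At height 0 the logarithms are combinations of iterated logarithms. At height
  \<open>Suc h\<close> they are combinations over the scale of height \<open>h\<close>, which is
  comparable by the induction hypothesis.\<close>

lemma logexp_upto_trichotomy:
  assumes "L \<in> logexp_upto h" "L' \<in> logexp_upto h"
  shows "lexp_eval L \<succ>\<^sub>g lexp_eval L' \<or> lexp_eval L' \<succ>\<^sub>g lexp_eval L \<or>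
         germ_eq (lexp_eval L) (lexp_eval L')"
  using assms
proof (induction h arbitrary: L L')
  case 0
  then have "snd ` set (log_terms L) \<subseteq> range iter_log" "snd ` set (log_terms L') \<subseteq> range iter_log"
    by (auto simp: log_terms_def simp del: iter_log_Suc)
  then show ?case by (rule lexp_eval_trichotomy_if_scale[OF comparable_scale_iter_log])
next
  case (Suc h)
  show ?case
    by (rule lexp_eval_trichotomy_if_scale[OF comparable_expression_scale[of "logexp_upto h", OF Suc.IH]
          log_terms_in_scale[OF Suc.prems(1)] log_terms_in_scale[OF Suc.prems(2)]])
qed

lemma logexp_trichotomy:
  assumes "L \<in> logexp" "L' \<in> logexp"
  shows "lexp_eval L \<succ>\<^sub>g lexp_eval L' \<or> lexp_eval L' \<succ>\<^sub>g lexp_eval L \<or>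
         germ_eq (lexp_eval L) (lexp_eval L')"
proof -
  from assms obtain h h' where "L \<in> logexp_upto h" "L' \<in> logexp_upto h'"
    by (auto simp: logexp_def)
  then have "L \<in> logexp_upto (max h h')" "L' \<in> logexp_upto (max h h')"
    using logexp_upto_mono[of h "max h h'"] logexp_upto_mono[of h' "max h h'"] by auto
  then show ?thesis by (rule logexp_upto_trichotomy)
qed

lemma log_terms_in_logexp_scale:
  assumes "L \<in> logexp"
  shows "snd ` set (log_terms L) \<subseteq> expression_scale logexp"
proof -
  from assms obtain h where "L \<in> logexp_upto h" by (auto simp: logexp_def)
  then have "L \<in> logexp_upto (Suc h)" by simp
  then have "snd ` set (log_terms L) \<subseteq> expression_scale (logexp_upto h)"
    by (rule log_terms_in_scale)
  also have "\<dots> \<subseteq> expression_scale logexp"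
    unfolding expression_scale_def logexp_def by blast
  finally show ?thesis .
qed

lemma comparable_logexp_scale: "comparable_scale (expression_scale logexp)"
  by (rule comparable_expression_scale) (rule logexp_trichotomy)

section \<open>Comparability of growth monomials\<close>

lemma filterlim_at_top_if_ratio:
  fixes f g :: "real \<Rightarrow> real"
  assumes "((\<lambda>x. f x / g x) \<longlongrightarrow> c) at_top" "c > 0" "filterlim g at_top at_top"
  shows "filterlim f at_top at_top"
proof -
  have "filterlim (\<lambda>x. f x / g x * g x) at_top at_top"
    by (rule filterlim_tendsto_pos_mult_at_top[OF assms])
  moreover have "\<forall>\<^sub>F x in at_top. g x > 0" using assms(3) by (simp add: filterlim_at_top_dense)
  then have "\<forall>\<^sub>F x in at_top. f x / g x * g x = f x" by eventually_elim simp
  ultimately show ?thesis by (rule filterlim_cong[OF refl refl, THEN iffD1, rotated])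
qed

lemma eventually_Gamma_affine_pos:
  assumes "(\<kappa>::real) > 0"
  shows "\<forall>\<^sub>F x in at_top. Gamma (\<kappa> * x + 1) > 0"
  using eventually_gt_at_top[of 0]
  by eventually_elim (use assms in \<open>auto intro!: Gamma_real_pos add_pos_pos\<close>)

lemma eventually_gmono_eval_pos:
  assumes "growth_monomial M"
  shows "\<forall>\<^sub>F x in at_top. gmono_eval M x > (0::real)"
proof (cases M)
  case (Pure L)
  then show ?thesis using eventually_lexp_eval_pos by simp
next
  case (GammaType l H \<kappa>)
  with assms have "\<kappa> > 0" by simp
  from eventually_Gamma_affine_pos[OF this] eventually_lexp_eval_pos[of H] show ?thesis
    by eventually_elim (simp add: GammaType gamma_germ_def)
qed

lemma ln_gamma_germ:
  fixes \<kappa> l :: real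
  assumes "\<kappa> > 0"
  shows "\<forall>\<^sub>F x in at_top. ln (gamma_germ l H \<kappa> x) =
    l * x + ln (lexp_eval H x) + ln (Gamma (\<kappa> * x + 1))"
  using eventually_Gamma_affine_pos[OF assms] eventually_lexp_eval_pos[of H]
  by eventually_elim (simp add: gamma_germ_def ln_mult_pos)

lemma logexp_sublin_limit:
  "H \<in> logexp_sublin \<Longrightarrow> ((\<lambda>x. ln (lexp_eval H x) / x) \<longlongrightarrow> (0::real)) at_top"
  by (auto simp: logexp_sublin_def dest: smalloD_tendsto)

lemma x_ln_x_at_top: "filterlim (\<lambda>x::real. x * ln x) at_top at_top"
  by real_asymp

text \<open>By Stirling's formula the Gamma factor contributes \<open>\<kappa> * (x * ln x)\<close>
  to leading order; \<open>exp (l * x)\<close> and the subexponential \<open>H\<close> contribute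
  only \<open>O(x)\<close>.\<close>

lemma ln_gamma_germ_leading:
  fixes \<kappa> l :: real
  assumes "H \<in> logexp_sublin" "\<kappa> > 0"
  shows "((\<lambda>x. ln (gamma_germ l H \<kappa> x) / (x * ln x)) \<longlongrightarrow> \<kappa>) at_top"
proof -
  let ?S = "\<lambda>x. \<kappa> * (x * ln x) + \<kappa> * (ln \<kappa> - 1) * x + 1/2 * ln x"
  obtain L where L: "((\<lambda>x. ln (Gamma (\<kappa> * x + 1)) - ?S x) \<longlongrightarrow> L) at_top"
    using ln_Gamma_affine_asymp[OF assms(2)] by blast
  have inv: "((\<lambda>x::real. 1 / ln x) \<longlongrightarrow> 0) at_top" "((\<lambda>x::real. 1 / (x * ln x)) \<longlongrightarrow> 0) at_top"
    "((\<lambda>x::real. 1 / x) \<longlongrightarrow> 0) at_top"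
    by real_asymp+
  \<comment> \<open>Every summand is a product of factors with known limits, so the limit rules
    apply termwise.\<close>
  have "((\<lambda>x. l * (1 / ln x) + ln (lexp_eval H x) / x * (1 / ln x) +
        (ln (Gamma (\<kappa> * x + 1)) - ?S x) * (1 / (x * ln x)) +
        (\<kappa> + \<kappa> * (ln \<kappa> - 1) * (1 / ln x) + 1/2 * (1 / x)))
      \<longlongrightarrow> l * 0 + 0 * 0 + L * 0 + (\<kappa> + \<kappa> * (ln \<kappa> - 1) * 0 + 1/2 * 0)) at_top"
    by (intro tendsto_intros inv L logexp_sublin_limit assms)
  then have "((\<lambda>x. l * (1 / ln x) + ln (lexp_eval H x) / x * (1 / ln x) +
        (ln (Gamma (\<kappa> * x + 1)) - ?S x) * (1 / (x * ln x)) +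
        (\<kappa> + \<kappa> * (ln \<kappa> - 1) * (1 / ln x) + 1/2 * (1 / x))) \<longlongrightarrow> \<kappa>) at_top"
    by simp
  moreover have "\<forall>\<^sub>F x in at_top. l * (1 / ln x) + ln (lexp_eval H x) / x * (1 / ln x) +
        (ln (Gamma (\<kappa> * x + 1)) - ?S x) * (1 / (x * ln x)) +
        (\<kappa> + \<kappa> * (ln \<kappa> - 1) * (1 / ln x) + 1/2 * (1 / x)) =
      ln (gamma_germ l H \<kappa> x) / (x * ln x)"
    using ln_gamma_germ[OF assms(2), of l H] eventually_gt_at_top[of 1]
  proof eventually_elim
    case (elim x)
    then have "x \<noteq> 0" "ln x \<noteq> 0" by auto
    then show ?case unfolding elim(1) by (simp add: field_simps)
  qed
  ultimately show ?thesis by (rule Lim_transform_eventually)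
qed

text \<open>The parameters are compared lexicographically. Different \<open>\<kappa>\<close> are
  separated on the scale \<open>x * ln x\<close>; for equal \<open>\<kappa>\<close> the Gamma
  factors cancel and different \<open>l\<close> are separated on the scale \<open>x\<close>, where
  \<open>ln H\<close> is negligible.\<close>

lemma gamma_germ_dominates:
  assumes "H \<in> logexp_sublin" "H' \<in> logexp_sublin" "\<kappa>' > 0"
    and "\<kappa> > \<kappa>' \<or> \<kappa> = \<kappa>' \<and> l > l'"
  shows "gamma_germ l H \<kappa> \<succ>\<^sub>g gamma_germ l' H' \<kappa>'"
proof -
  have "\<kappa> > 0" using assms by auto
  let ?D = "\<lambda>x::real. ln (gamma_germ l H \<kappa> x) - ln (gamma_germ l' H' \<kappa>' x)"
  have pos: "\<forall>\<^sub>F x in at_top. gamma_germ l H \<kappa> x > (0::real)"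
       "\<forall>\<^sub>F x in at_top. gamma_germ l' H' \<kappa>' x > (0::real)"
    using eventually_gmono_eval_pos[of "GammaType l H \<kappa>"] assms \<open>\<kappa> > 0\<close>
      eventually_gmono_eval_pos[of "GammaType l' H' \<kappa>'"] by simp_all
  have "filterlim ?D at_top at_top"
  proof (cases "\<kappa> = \<kappa>'")
    case False
    with assms have "\<kappa> - \<kappa>' > 0" by auto
    have "((\<lambda>x. ln (gamma_germ l H \<kappa> x) / (x * ln x) - ln (gamma_germ l' H' \<kappa>' x) / (x * ln x))
        \<longlongrightarrow> \<kappa> - \<kappa>') at_top"
      using assms \<open>\<kappa> > 0\<close> by (intro tendsto_diff ln_gamma_germ_leading)
    then have "((\<lambda>x. ?D x / (x * ln x)) \<longlongrightarrow> \<kappa> - \<kappa>') at_top"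
      by (simp add: diff_divide_distrib)
    then show ?thesis
      using \<open>\<kappa> - \<kappa>' > 0\<close> x_ln_x_at_top by (rule filterlim_at_top_if_ratio)
  next
    case True
    with assms have "l - l' > 0" by auto
    have "((\<lambda>x. (l - l') + (ln (lexp_eval H x) / x - ln (lexp_eval H' x) / x)) \<longlongrightarrow> (l - l') + (0 - 0)) at_top"
      by (intro tendsto_intros logexp_sublin_limit assms)
    then have "((\<lambda>x. (l - l') + (ln (lexp_eval H x) / x - ln (lexp_eval H' x) / x)) \<longlongrightarrow> l - l') at_top"
      by simp
    moreover have "\<forall>\<^sub>F x in at_top. (l - l') + (ln (lexp_eval H x) / x - ln (lexp_eval H' x) / x) = ?D x / x"
      using ln_gamma_germ[OF \<open>\<kappa> > 0\<close>, of l H] ln_gamma_germ[OF \<open>\<kappa>' > 0\<close>, of l' H'] eventually_gt_at_top[of 0]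
    proof eventually_elim
      case (elim x)
      then show ?case unfolding elim(1,2) by (simp add: True field_simps)
    qed
    ultimately have "((\<lambda>x. ?D x / x) \<longlongrightarrow> l - l') at_top" by (rule Lim_transform_eventually)
    then show ?thesis
      using \<open>l - l' > 0\<close> filterlim_ident by (rule filterlim_at_top_if_ratio)
  qed
  then show ?thesis by (rule dominates_if_ln_diff[OF pos])
qed

text \<open>When both parameters agree, the quotient is that of the factors \<open>H\<close> and
  \<open>H'\<close>, and the comparison of log-exp monomials decides.\<close>

lemma gamma_germ_trichotomy:
  assumes "H \<in> logexp_sublin" "H' \<in> logexp_sublin" "\<kappa> > 0" "\<kappa>' > 0"
  shows "gamma_germ l H \<kappa> \<succ>\<^sub>g gamma_germ l' H' \<kappa>' \<or> gamma_germ l' H' \<kappa>' \<succ>\<^sub>g gamma_germ l H \<kappa> \<or>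
         germ_eq (gamma_germ l H \<kappa>) (gamma_germ l' H' \<kappa>')"
proof (cases "\<kappa> = \<kappa>' \<and> l = l'")
  case False
  then have "(\<kappa> > \<kappa>' \<or> \<kappa> = \<kappa>' \<and> l > l') \<or> (\<kappa>' > \<kappa> \<or> \<kappa>' = \<kappa> \<and> l' > l)" by auto
  then show ?thesis using gamma_germ_dominates assms by blast
next
  case True
  have *: "gamma_germ l H1 \<kappa> \<succ>\<^sub>g gamma_germ l H2 \<kappa>" if "lexp_eval H1 \<succ>\<^sub>g lexp_eval H2" for H1 H2
  proof -
    have "\<forall>\<^sub>F x in at_top. lexp_eval H2 x / lexp_eval H1 x = gamma_germ l H2 \<kappa> x / (gamma_germ l H1 \<kappa> x :: real)"
      using eventually_Gamma_affine_pos[OF \<open>\<kappa> > 0\<close>] by eventually_elim (simp add: gamma_germ_def)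
    with that show ?thesis unfolding dominates_def by (rule Lim_transform_eventually)
  qed
  have "germ_eq (gamma_germ l H \<kappa>) (gamma_germ l H' \<kappa>)" if "germ_eq (lexp_eval H) (lexp_eval H')"
    using that unfolding germ_eq_def by eventually_elim (simp add: gamma_germ_def)
  moreover have "H \<in> logexp" "H' \<in> logexp" using assms by (auto simp: logexp_sublin_def)
  ultimately show ?thesis using logexp_trichotomy[of H H'] * True by blast
qed

text \<open>Up to a convergent remainder from Stirling's formula, the logarithm of the quotient is a
  linear combination over the log-exp scale. If that combination vanished, the quotient would have a
  positive limit, which is resonance; hence only two alternatives remain.\<close>

lemma pure_gamma_trichotomy:
  assumes "L \<in> logexp" "\<not> gamma_resonant L" "H \<in> logexp_sublin" "\<kappa> > 0"
  shows "lexp_eval L \<succ>\<^sub>g gamma_germ l H \<kappa> \<or> gamma_germ l H \<kappa> \<succ>\<^sub>g lexp_eval L"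
proof -
  let ?S = "\<lambda>x. \<kappa> * (x * ln x) + \<kappa> * (ln \<kappa> - 1) * x + 1/2 * ln x"
  obtain K where K: "((\<lambda>x. ln (Gamma (\<kappa> * x + 1)) - ?S x) \<longlongrightarrow> K) at_top"
    using ln_Gamma_affine_asymp[OF assms(4)] by blast
  let ?D = "\<lambda>x::real. ln (lexp_eval L x) - ln (gamma_germ l H \<kappa> x)"
  have pos: "\<forall>\<^sub>F x in at_top. gamma_germ l H \<kappa> x > (0::real)"
    using eventually_gmono_eval_pos[of "GammaType l H \<kappa>"] assms by simp
  \<comment> \<open>An expression of height 0 for \<open>x * ln x\<close>, so that the main term of
    Stirling's formula lies in the scale.\<close>
  define M where "M = LExp [] [1, 1]"
  have M: "germ_eq (lexp_eval M) (\<lambda>x. x * ln x)"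
    using eventually_gt_at_top[of 1] unfolding germ_eq_def M_def
    by eventually_elim (simp add: lessThan_Suc)
  have "M \<in> logexp_upto 0" by (simp add: M_def)
  then have "M \<in> logexp" unfolding logexp_def by blast
  with M have xlnx: "(\<lambda>x. x * ln x) \<in> expression_scale logexp"
    using x_ln_x_at_top by (auto simp: expression_scale_def)
  have "expression_scale (logexp_upto 0) \<subseteq> expression_scale logexp"
    unfolding expression_scale_def logexp_def by blast
  then have logs: "iter_log j \<in> expression_scale logexp" for j
    using iter_log_in_expression_scale[of j 0] by blast
  \<comment> \<open>The appended terms are the negatives of the Stirling terms and of the exponent
    \<open>l * x\<close>; the two contributions to the coefficient of \<open>x\<close>, written as
    \<open>iter_log 0\<close>, are merged.\<close>
  define xs where "xs = log_terms L @ scale_by (-1) (log_terms H) @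
    [(- \<kappa>, \<lambda>x. x * ln x), (- (\<kappa> * (ln \<kappa> - 1)) - l, iter_log 0), (- (1/2), iter_log 1)]"
  have "snd ` set xs = snd ` set (log_terms L) \<union> snd ` set (log_terms H) \<union>
      {\<lambda>x. x * ln x, iter_log 0, iter_log 1}"
    unfolding xs_def set_append image_Un functions_scale_by by auto
  moreover have "H \<in> logexp" using assms(3) by (simp add: logexp_sublin_def)
  ultimately have sub: "snd ` set xs \<subseteq> expression_scale logexp"
    using log_terms_in_logexp_scale[OF assms(1)] log_terms_in_logexp_scale[of H] xlnx logs by simp
  have "((\<lambda>x. - (ln (Gamma (\<kappa> * x + 1)) - ?S x)) \<longlongrightarrow> - K) at_top"
    by (intro tendsto_intros K)
  moreover have "\<forall>\<^sub>F x in at_top. - (ln (Gamma (\<kappa> * x + 1)) - ?S x) = ?D x - combo xs x"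
    using ln_gamma_germ[OF assms(4), of l H] ln_lexp_eval[of L] ln_lexp_eval[of H]
    unfolding germ_eq_def
  proof eventually_elim
    case (elim x)
    show ?case unfolding elim(1) by (simp add: xs_def elim(2,3) algebra_simps)
  qed
  ultimately have rem: "((\<lambda>x. ?D x - combo xs x) \<longlongrightarrow> - K) at_top"
    by (rule Lim_transform_eventually)
  from combo_trichotomy[OF comparable_logexp_scale sub]
  consider "filterlim (combo xs) at_top at_top" | "filterlim (combo xs) at_bot at_top"
    | "germ_eq (combo xs) (\<lambda>_. 0)" by blast
  then show ?thesis
  proof cases
    case 1
    from filterlim_tendsto_add_at_top[OF rem this]
    have "filterlim ?D at_top at_top" by simp
    then show ?thesis using dominates_if_ln_diff[OF eventually_lexp_eval_pos pos] by blast
  next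
    case 2
    then have "filterlim (\<lambda>x. - combo xs x) at_top at_top" by (simp add: filterlim_uminus_at_bot)
    from filterlim_tendsto_add_at_top[OF tendsto_minus[OF rem] this]
    have "filterlim (\<lambda>x::real. ln (gamma_germ l H \<kappa> x) - ln (lexp_eval L x)) at_top at_top" by simp
    then show ?thesis using dominates_if_ln_diff[OF pos eventually_lexp_eval_pos] by blast
  next
    case 3
    have "((\<lambda>x. exp (?D x - combo xs x)) \<longlongrightarrow> exp (- K)) at_top"
      by (intro tendsto_intros rem)
    moreover have "\<forall>\<^sub>F x in at_top. exp (?D x - combo xs x) = lexp_eval L x / gamma_germ l H \<kappa> x"
      using 3 pos eventually_lexp_eval_pos[of L] unfolding germ_eq_def
      by eventually_elim (simp add: exp_diff)
    ultimately have "((\<lambda>x. lexp_eval L x / gamma_germ l H \<kappa> x) \<longlongrightarrow> exp (- K)) at_top"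
      by (rule Lim_transform_eventually)
    then have "gamma_resonant L"
      using assms(3,4) unfolding gamma_resonant_def by (metis exp_gt_zero)
    with assms(2) show ?thesis ..
  qed
qed

lemma growth_monomial_trichotomy:
  assumes "growth_monomial M" "growth_monomial M'"
  shows "gmono_eval M \<succ>\<^sub>g gmono_eval M' \<or> gmono_eval M' \<succ>\<^sub>g gmono_eval M \<or>
         germ_eq (gmono_eval M) (gmono_eval M')"
proof -
  have ev: "(gmono_eval (Pure L) :: real \<Rightarrow> real) = lexp_eval L"
    "(gmono_eval (GammaType l H \<kappa>) :: real \<Rightarrow> real) = gamma_germ l H \<kappa>" for L l H \<kappa>
    by (simp_all add: fun_eq_iff)
  show ?thesis
    using assms
    by (cases M; cases M')
      (simp_all only: ev growth_monomial.simps,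
        (use logexp_trichotomy gamma_germ_trichotomy pure_gamma_trichotomy in blast)+)
qed

section \<open>Uniqueness of the continuation\<close>

abbreviation right_half_plane :: "real \<Rightarrow> complex set" where
  "right_half_plane s \<equiv> {z. Re z > s}"

text \<open>Quantifying over all large \<open>s\<close> instead of a single one lets finitely many
  half-planes be intersected by combining eventualities.\<close>

definition eventually_holomorphic :: "(complex \<Rightarrow> complex) \<Rightarrow> bool" where
  "eventually_holomorphic f \<longleftrightarrow> (\<forall>\<^sub>F s in at_top. f holomorphic_on right_half_plane s)"

section \<open>Holomorphy of the canonical continuation\<close>

lemma eventually_holomorphicI:
  assumes "f holomorphic_on right_half_plane s"
  shows "eventually_holomorphic f"
  unfolding eventually_holomorphic_def using eventually_ge_at_top[of s]
  by eventually_elim (rule holomorphic_on_subset[OF assms], auto)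

lemma eventually_holomorphic_add:
  assumes "eventually_holomorphic f" "eventually_holomorphic g"
  shows "eventually_holomorphic (\<lambda>z. f z + g z)"
  using assms unfolding eventually_holomorphic_def
  by eventually_elim (rule holomorphic_on_add)

lemma eventually_holomorphic_mult:
  assumes "eventually_holomorphic f" "eventually_holomorphic g"
  shows "eventually_holomorphic (\<lambda>z. f z * g z)"
  using assms unfolding eventually_holomorphic_def
  by eventually_elim (rule holomorphic_on_mult)

lemma eventually_holomorphic_const: "eventually_holomorphic (\<lambda>z. c)"
  by (rule eventually_holomorphicI[of _ 0]) (rule holomorphic_on_const)

lemma eventually_holomorphic_exp:
  "eventually_holomorphic f \<Longrightarrow> eventually_holomorphic (\<lambda>z. exp (f z))"
  unfolding eventually_holomorphic_def
  by (auto elim!: eventually_mono intro: holomorphic_on_exp')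

lemma eventually_holomorphic_sum_list:
  assumes "\<And>x. x \<in> set xs \<Longrightarrow> eventually_holomorphic (f x)"
  shows "eventually_holomorphic (\<lambda>z. \<Sum>x\<leftarrow>xs. f x z)"
  using assms
  by (induction xs) (auto intro: eventually_holomorphic_const eventually_holomorphic_add)

lemma eventually_holomorphic_prod:
  fixes n :: nat
  assumes "\<And>j. j < n \<Longrightarrow> eventually_holomorphic (f j)"
  shows "eventually_holomorphic (\<lambda>z. \<Prod>j<n. f j z)"
  using assms
  by (induction n) (auto intro: eventually_holomorphic_const eventually_holomorphic_mult)

text \<open>A positive real part keeps \<open>iter_log j\<close> off the branch cut of
  \<open>ln\<close>. The arbitrary bound \<open>K\<close> carries the induction: a real part above
  \<open>exp K\<close> gives a modulus above \<open>exp K\<close>, and the real part of the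
  logarithm is the logarithm of the modulus.\<close>

lemma iter_log_half_plane:
  "\<exists>s. iter_log j holomorphic_on right_half_plane s \<and> (\<forall>z\<in>right_half_plane s. Re (iter_log j z) > K)"
proof (induction j arbitrary: K)
  case 0
  have "(\<lambda>z. z) holomorphic_on right_half_plane K" by (rule holomorphic_on_ident)
  moreover have "iter_log 0 = (\<lambda>z::complex. z)" by (simp add: fun_eq_iff)
  ultimately show ?case by (intro exI[of _ K]) simp
next
  case (Suc j)
  from Suc[of "exp K"] obtain s where s: "iter_log j holomorphic_on right_half_plane s"
    "\<And>z. Re z > s \<Longrightarrow> Re (iter_log j z) > exp K" by auto
  have pos: "Re (iter_log j z) > 0" if "Re z > s" for z
    using s(2)[OF that] exp_gt_zero[of K] by linarith
  have "(\<lambda>z. ln (iter_log j z)) holomorphic_on right_half_plane s"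
    using pos by (intro holomorphic_on_Ln' s(1)) (auto simp: complex_nonpos_Reals_iff not_le)
  moreover have "iter_log (Suc j) = (\<lambda>z::complex. ln (iter_log j z))" by (simp add: fun_eq_iff)
  moreover have "Re (ln (iter_log j z)) > K" if "Re z > s" for z
  proof -
    have "exp K < norm (iter_log j z)"
      using s(2)[OF that] complex_Re_le_cmod[of "iter_log j z"] by linarith
    then have "ln (exp K) < ln (norm (iter_log j z))"
      using exp_gt_zero[of K] by (subst ln_less_cancel_iff) linarith+
    moreover have "iter_log j z \<noteq> 0" using pos[OF that] by auto
    ultimately show ?thesis by simp
  qed
  ultimately show ?case by (intro exI[of _ s]) simp
qed

lemma eventually_holomorphic_iter_log_powr: "eventually_holomorphic (\<lambda>z. iter_log j z powr a)"
proof -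
  obtain s where s: "iter_log j holomorphic_on right_half_plane s"
    "\<forall>z\<in>right_half_plane s. Re (iter_log j z) > 0" using iter_log_half_plane[of j 0] by blast
  have "(\<lambda>z. iter_log j z powr a) holomorphic_on right_half_plane s"
    using s(2) by (intro holomorphic_on_powr s(1) holomorphic_on_const)
      (auto simp: complex_nonpos_Reals_iff not_le)
  then show ?thesis by (rule eventually_holomorphicI)
qed

lemma eventually_holomorphic_lexp_eval: "eventually_holomorphic (lexp_eval L)"
proof (induction L)
  case (LExp \<Phi> \<alpha>)
  have "eventually_holomorphic (\<lambda>z. (case p of (c, M) \<Rightarrow> of_real c * lexp_eval M z))"
    if "p \<in> set \<Phi>" for p
  proof -
    obtain c M where p: "p = (c, M)" by fastforce
    then have "eventually_holomorphic (lexp_eval M)" using LExp that by (auto intro: snds.intros)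
    then show ?thesis
      by (simp add: p eventually_holomorphic_mult eventually_holomorphic_const)
  qed
  then have "eventually_holomorphic (\<lambda>z. exp (\<Sum>(c, M)\<leftarrow>\<Phi>. of_real c * lexp_eval M z) *
      (\<Prod>j<length \<alpha>. iter_log j z powr of_real (\<alpha> ! j)))"
    by (intro eventually_holomorphic_mult eventually_holomorphic_exp eventually_holomorphic_sum_list
        eventually_holomorphic_prod eventually_holomorphic_iter_log_powr)
  then show ?case by (simp add: fun_eq_iff cong: arg_cong[of _ _ eventually_holomorphic])
qed

section \<open>Agreement with the real germ and the identity theorem\<close>

lemma iter_log_of_real:
  assumes "\<forall>i\<le>j. iter_log i x > (0::real)"
  shows "iter_log j (complex_of_real x) = of_real (iter_log j x)"
  using assms
proof (induction j)
  case (Suc j)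
  then have "iter_log j x > 0" by simp
  with Suc show ?case by (simp add: Ln_of_real)
qed simp

lemma lexp_eval_of_real: "\<forall>\<^sub>F x in at_top. lexp_eval L (complex_of_real x) = of_real (lexp_eval L x)"
proof (induction L)
  case (LExp \<Phi> \<alpha>)
  have "\<forall>\<^sub>F x in at_top. \<forall>p\<in>set \<Phi>. lexp_eval (snd p) (complex_of_real x) = of_real (lexp_eval (snd p) x)"
    using LExp by (intro eventually_ball_finite) (auto intro: snds.intros)
  with eventually_iter_log_pos[of "length \<alpha>"] show ?case
  proof eventually_elim
    case (elim x)
    have "(\<Sum>(c, M)\<leftarrow>\<Phi>. of_real c * lexp_eval M (complex_of_real x)) =
        of_real (\<Sum>(c, M)\<leftarrow>\<Phi>. of_real c * lexp_eval M x)"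
      using elim(2) by (induction \<Phi>) auto
    moreover have "iter_log j (complex_of_real x) powr of_real (\<alpha> ! j) =
        of_real (iter_log j x powr (\<alpha> ! j))" if "j < length \<alpha>" for j
    proof -
      have "iter_log j (complex_of_real x) = of_real (iter_log j x)"
        using elim(1) that by (intro iter_log_of_real) auto
      moreover have "iter_log j x \<ge> 0" using elim(1)[rule_format, of j] that by simp
      ultimately show ?thesis by (simp add: powr_of_real)
    qed
    ultimately show ?case by (simp add: exp_of_real)
  qed
qed

lemma eventually_holomorphic_gmono_eval:
  assumes "growth_monomial M"
  shows "eventually_holomorphic (gmono_eval M)"
proof (cases M)
  case (Pure L)
  then show ?thesis using eventually_holomorphic_lexp_eval[of L] by (simp add: gmono_eval_def)
next
  case (GammaType l H \<kappa>)
  with assms have "\<kappa> > 0" by simp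
  \<comment> \<open>The poles of Gamma are the nonpositive integers, and
    \<open>\<kappa> * z + 1\<close> stays to the right of them.\<close>
  have "Re (of_real \<kappa> * z + 1) > 0" if "Re z > 0" for z
    using that \<open>\<kappa> > 0\<close> by (simp add: add_pos_pos)
  then have "of_real \<kappa> * z + 1 \<notin> \<int>\<^sub>\<le>\<^sub>0" if "Re z > 0" for z
    using that by (metis nonpos_Ints_subset_nonpos_Reals complex_nonpos_Reals_iff not_le subsetD)
  then have "(\<lambda>z. Gamma (of_real \<kappa> * z + 1)) holomorphic_on right_half_plane 0"
    by (intro holomorphic_intros) auto
  then have "eventually_holomorphic (\<lambda>z. Gamma (of_real \<kappa> * z + 1))"
    by (rule eventually_holomorphicI)
  moreover have "eventually_holomorphic (\<lambda>z. exp (of_real l * z))"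
    by (rule eventually_holomorphicI[of _ 0]) (intro holomorphic_intros)
  ultimately have "eventually_holomorphic (\<lambda>z. exp (of_real l * z) * lexp_eval H z * Gamma (of_real \<kappa> * z + 1))"
    by (intro eventually_holomorphic_mult eventually_holomorphic_lexp_eval)
  moreover have "gmono_eval M = (\<lambda>z::complex. exp (of_real l * z) * lexp_eval H z * Gamma (of_real \<kappa> * z + 1))"
    by (simp add: fun_eq_iff GammaType gamma_germ_def)
  ultimately show ?thesis by simp
qed

lemma gmono_eval_of_real:
  "\<forall>\<^sub>F x in at_top. gmono_eval M (complex_of_real x) = of_real (gmono_eval M x)"
proof (cases M)
  case (Pure L)
  then show ?thesis using lexp_eval_of_real by simp
next
  case (GammaType l H \<kappa>)
  show ?thesis using lexp_eval_of_real[of H]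
  proof eventually_elim
    case (elim x)
    have "Gamma (of_real \<kappa> * complex_of_real x + 1) = of_real (Gamma (\<kappa> * x + 1))"
      using Gamma_complex_of_real[of "\<kappa> * x + 1"] by simp
    with elim show ?case by (simp add: GammaType gamma_germ_def exp_of_real[symmetric])
  qed
qed

text \<open>Both continuations are holomorphic on a common right half-plane and agree on its part of
  the real axis, so the identity theorem applies. Different growth monomials with one germ therefore
  continue alike far to the right.\<close>

lemma gmono_eval_continuation_unique:
  assumes "growth_monomial M" "growth_monomial M'" "germ_eq (gmono_eval M) (gmono_eval M')"
  shows "\<forall>\<^sub>F s in at_top. \<forall>z\<in>right_half_plane s. gmono_eval M z = gmono_eval M' z"
proof -
  have "\<forall>\<^sub>F x in at_top. gmono_eval M (complex_of_real x) = gmono_eval M' (complex_of_real x)"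
    using gmono_eval_of_real[of M] gmono_eval_of_real[of M'] assms(3) unfolding germ_eq_def
    by eventually_elim simp
  then obtain s0 where s0: "\<And>x. x \<ge> s0 \<Longrightarrow> gmono_eval M (complex_of_real x) = gmono_eval M' (complex_of_real x)"
    by (auto simp: eventually_at_top_linorder)
  show ?thesis
    using eventually_holomorphic_gmono_eval[OF assms(1)] eventually_holomorphic_gmono_eval[OF assms(2)]
      eventually_ge_at_top[of s0] unfolding eventually_holomorphic_def
  proof eventually_elim
    case (elim s)
    let ?f = "\<lambda>z. gmono_eval M z - gmono_eval M' z :: complex"
    let ?U = "complex_of_real ` {s<..}"
    have hol: "?f holomorphic_on right_half_plane s" using elim by (intro holomorphic_on_diff)
    \<comment> \<open>Any point of the open ray can serve as the accumulation point inside the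
      half-plane; \<open>s + 1\<close> is one.\<close>
    have lim: "complex_of_real (s + 1) islimpt ?U"
      unfolding islimpt_approachable
    proof (intro allI impI)
      fix e :: real assume "e > 0"
      have "complex_of_real (s + 1 + e / 2) \<in> ?U" using \<open>e > 0\<close> by (intro imageI) auto
      moreover have "complex_of_real (s + 1 + e / 2) \<noteq> complex_of_real (s + 1)"
        using \<open>e > 0\<close> unfolding of_real_eq_iff by simp
      moreover have "dist (complex_of_real (s + 1 + e / 2)) (complex_of_real (s + 1)) < e"
        using \<open>e > 0\<close> unfolding dist_of_real by (simp add: dist_real_def)
      ultimately show "\<exists>x'\<in>?U. x' \<noteq> complex_of_real (s + 1) \<and> dist x' (complex_of_real (s + 1)) < e"
        by blast
    qed
    show ?case
    proof
      fix z assume z: "z \<in> right_half_plane s"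
      have "?f z = 0"
        by (rule analytic_continuation[OF hol _ _ _ _ lim])
          (use s0 elim z in \<open>auto intro: open_halfspace_Re_gt convex_connected convex_halfspace_Re_gt\<close>)
      then show "gmono_eval M z = gmono_eval M' z" by simp
    qed
  qed
qed

section \<open>Values at large integers determine an expression of \<open>MM\<close>\<close>

lemma phase_simps [simp]:
  "phase_plus [] = []" "phase_minus [] = []"
  "phase_plus ((A, B, M) # c) = (if A \<noteq> 0 then [(A, M)] else []) @ phase_plus c"
  "phase_minus ((A, B, M) # c) = (if B \<noteq> 0 then [(B, M)] else []) @ phase_minus c"
  by (simp_all add: phase_plus_def phase_minus_def)

lemma continuation_simps [simp]:
  "continuation [] z = 0"
  "continuation ((C, M) # a) z = C * gmono_eval M z + continuation a z"
  "continuation (a @ b) z = continuation a z + continuation b z"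
  by (simp_all add: continuation_def)

lemma MM_germ_nat:
  "MM_germ c (real N) = (\<Sum>(A, B, M)\<leftarrow>c. (A + B * (-1) ^ N) * of_real (gmono_eval M (real N)))"
proof -
  have "exp (\<i> * of_real pi * of_real (real N)) = (-1) ^ N"
    by (metis exp_of_nat2_mult exp_pi_i' mult.commute of_real_of_nat_eq)
  then show ?thesis by (simp add: MM_germ_def)
qed

lemma MM_germ_nat_simps [simp]:
  "MM_germ [] (real N) = 0"
  "MM_germ ((A, B, M) # c) (real N) =
     (A + B * (-1) ^ N) * of_real (gmono_eval M (real N)) + MM_germ c (real N)"
  by (simp_all add: MM_germ_nat)

lemma MM_Cons:
  "(A, B, M) # c \<in> MM \<longleftrightarrow> (A \<noteq> 0 \<or> B \<noteq> 0) \<and> growth_monomial M \<and>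
     (\<forall>(A', B', M')\<in>set c. gmono_eval M \<succ>\<^sub>g gmono_eval M') \<and> c \<in> MM"
  by (auto simp: MM_def)

lemma eventually_sequentially_real:
  "(\<forall>\<^sub>F x in at_top. P x) \<Longrightarrow> (\<forall>\<^sub>F N in sequentially. P (real N))"
  using filterlim_real_sequentially by (simp add: filterlim_iff)

text \<open>The oscillating coefficients \<open>A + B * (-1) ^ N\<close> are bounded by
  \<open>norm A + norm B\<close>, so domination of the monomials is enough.\<close>

lemma MM_germ_dominated:
  assumes "\<forall>(A', B', M')\<in>set c. gmono_eval M \<succ>\<^sub>g gmono_eval M'"
  shows "(\<lambda>N. MM_germ c (real N) / of_real (gmono_eval M (real N))) \<longlonglongrightarrow> 0"
  using assms
proof (induction c)
  case (Cons p c)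
  obtain A B M' where p: "p = (A, B, M')" using prod_cases3 by blast
  let ?q = "\<lambda>N. gmono_eval M' (real N) / gmono_eval M (real N) :: real"
  from Cons.prems p have "((\<lambda>x. gmono_eval M' x / gmono_eval M x :: real) \<longlongrightarrow> 0) at_top"
    by (simp add: dominates_def)
  then have "?q \<longlonglongrightarrow> 0" by (rule filterlim_compose[OF _ filterlim_real_sequentially])
  then have lim: "(\<lambda>N. (norm A + norm B) * norm (?q N)) \<longlonglongrightarrow> 0"
    by (intro tendsto_mult_right_zero tendsto_norm_zero)
  have "(\<lambda>N. (A + B * (-1) ^ N) * of_real (?q N)) \<longlonglongrightarrow> 0"
  proof (rule Lim_null_comparison[OF always_eventually lim], rule allI)
    fix N
    have "norm (A + B * (-1) ^ N) \<le> norm A + norm B"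
      using norm_triangle_ineq[of A "B * (-1) ^ N"] by (simp add: norm_mult norm_power)
    then show "norm ((A + B * (-1) ^ N) * of_real (?q N)) \<le> (norm A + norm B) * norm (?q N)"
      unfolding norm_mult norm_of_real real_norm_def by (rule mult_right_mono) simp
  qed
  moreover have "(\<lambda>N. MM_germ c (real N) / of_real (gmono_eval M (real N))) \<longlonglongrightarrow> 0"
    using Cons by simp
  ultimately have "(\<lambda>N. (A + B * (-1) ^ N) * of_real (?q N) +
      MM_germ c (real N) / of_real (gmono_eval M (real N))) \<longlonglongrightarrow> 0 + 0"
    by (rule tendsto_add)
  then show ?case by (simp add: p add_divide_distrib)
qed simp

text \<open>After division by \<open>f\<close>, the sequence \<open>A + B * (-1) ^ N\<close> tends
  to 0; its even and odd subsequences are the constants \<open>A + B\<close> and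
  \<open>A - B\<close>.\<close>

lemma leading_coefficients_zero:
  fixes A B :: complex
  assumes "\<forall>\<^sub>F x in at_top. f x > (0::real)"
    and "\<forall>\<^sub>F N in sequentially. (A + B * (-1) ^ N) * of_real (f (real N)) + X N = 0"
    and "(\<lambda>N. X N / of_real (f (real N))) \<longlonglongrightarrow> 0"
  shows "A = 0 \<and> B = 0"
proof -
  have "\<forall>\<^sub>F N in sequentially. - (X N / of_real (f (real N))) = A + B * (-1) ^ N"
    using assms(2) eventually_sequentially_real[OF assms(1)]
  proof eventually_elim
    case (elim N)
    then have "X N = - ((A + B * (-1) ^ N) * of_real (f (real N)))"
      by (simp add: eq_neg_iff_add_eq_0 add.commute)
    with elim(2) show ?case by simp
  qed
  with tendsto_minus[OF assms(3)] have lim: "(\<lambda>N. A + B * (-1) ^ N) \<longlonglongrightarrow> 0"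
    using Lim_transform_eventually by fastforce
  have "strict_mono (\<lambda>n::nat. 2 * n)" "strict_mono (\<lambda>n::nat. 2 * n + 1)"
    by (simp_all add: strict_mono_def)
  from this[THEN LIMSEQ_subseq_LIMSEQ[OF lim]] have "A + B = 0" "A - B = 0"
    by (simp_all add: o_def LIMSEQ_const_iff)
  then show ?thesis by auto
qed

text \<open>Leading terms are removed one at a time. If one leading monomial dominated the other,
  its coefficients would both vanish; so by trichotomy the two germs agree, and then the differences
  of the leading coefficients vanish as well. Monomials are determined only up to equality of germs,
  since several expressions may have the same germ.\<close>

lemma MM_expression_unique:
  assumes "c \<in> MM" "c' \<in> MM"
    and "\<forall>\<^sub>F N in sequentially. MM_germ c (real N) = MM_germ c' (real N)"
  shows "list_all2 (\<lambda>(A, B, M) (A', B', M'). A = A' \<and> B = B' \<and> growth_monomial M \<and>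
           growth_monomial M' \<and> germ_eq (gmono_eval M) (gmono_eval M')) c c'"
  using assms
proof (induction c arbitrary: c')
  case Nil
  show ?case
  proof (cases c')
    case (Cons p r)
    obtain A B M where p: "p = (A, B, M)" using prod_cases3 by blast
    have M: "(A, B, M) # r \<in> MM" using Nil.prems Cons p by simp
    have "A = 0 \<and> B = 0"
      by (rule leading_coefficients_zero[where f = "gmono_eval M" and X = "\<lambda>N. MM_germ r (real N)"])
        (use M Nil.prems(3) in \<open>auto simp: MM_Cons Cons p eq_commute[of 0]
           intro: eventually_gmono_eval_pos MM_germ_dominated\<close>)
    with M show ?thesis by (simp add: MM_Cons)
  qed simp
next
  case (Cons p r)
  obtain A B M where p: "p = (A, B, M)" using prod_cases3 by blast
  have M: "(A, B, M) # r \<in> MM" using Cons.prems p by simp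
  then have gM: "growth_monomial M" by (simp add: MM_Cons)
  note posM = eventually_gmono_eval_pos[OF gM]
  have limr: "(\<lambda>N. MM_germ r (real N) / of_real (gmono_eval M (real N))) \<longlonglongrightarrow> 0"
    using M by (intro MM_germ_dominated) (simp add: MM_Cons)
  show ?case
  proof (cases c')
    case Nil
    have "A = 0 \<and> B = 0"
      by (rule leading_coefficients_zero[where f = "gmono_eval M" and X = "\<lambda>N. MM_germ r (real N)"])
        (use posM limr Cons.prems(3) in \<open>auto simp: Nil p\<close>)
    with M show ?thesis by (simp add: MM_Cons)
  next
    case c': (Cons p' r')
    obtain A' B' M' where p': "p' = (A', B', M')" using prod_cases3 by blast
    have M': "(A', B', M') # r' \<in> MM" using Cons.prems c' p' by simp
    then have gM': "growth_monomial M'" by (simp add: MM_Cons)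
    note posM' = eventually_gmono_eval_pos[OF gM']
    have limr': "(\<lambda>N. MM_germ r' (real N) / of_real (gmono_eval M' (real N))) \<longlonglongrightarrow> 0"
      using M' by (intro MM_germ_dominated) (simp add: MM_Cons)
    have eq: "\<forall>\<^sub>F N in sequentially. MM_germ ((A, B, M) # r) (real N) = MM_germ ((A', B', M') # r') (real N)"
      using Cons.prems(3) by (simp add: c' p p')
    \<comment> \<open>Stated for generic terms so that it excludes domination in both
      directions.\<close>
    have not_dom: False
      if "gmono_eval M1 \<succ>\<^sub>g gmono_eval M2" "(A1, B1, M1) # r1 \<in> MM" "(A2, B2, M2) # r2 \<in> MM"
        "\<forall>\<^sub>F N in sequentially. MM_germ ((A1, B1, M1) # r1) (real N) = MM_germ ((A2, B2, M2) # r2) (real N)"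
      for A1 B1 M1 r1 A2 B2 M2 r2
    proof -
      have g: "growth_monomial M1" "growth_monomial M2" using that by (simp_all add: MM_Cons)
      have nz: "\<forall>\<^sub>F x in at_top. gmono_eval M2 x \<noteq> (0::real)"
        using eventually_gmono_eval_pos[OF g(2)] by eventually_elim simp
      have "\<forall>(A, B, M)\<in>set ((A2, B2, M2) # r2). gmono_eval M1 \<succ>\<^sub>g gmono_eval M"
        using that(1,3) nz by (auto simp: MM_Cons intro: dominates_trans)
      then have "(\<lambda>N. MM_germ r1 (real N) / of_real (gmono_eval M1 (real N)) -
          MM_germ ((A2, B2, M2) # r2) (real N) / of_real (gmono_eval M1 (real N))) \<longlonglongrightarrow> 0 - 0"
        using that(2) by (intro tendsto_diff MM_germ_dominated) (simp_all add: MM_Cons)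
      then have lim: "(\<lambda>N. (MM_germ r1 (real N) - MM_germ ((A2, B2, M2) # r2) (real N)) /
          of_real (gmono_eval M1 (real N))) \<longlonglongrightarrow> 0"
        by (simp only: diff_divide_distrib diff_zero)
      have "\<forall>\<^sub>F N in sequentially. (A1 + B1 * (-1) ^ N) * of_real (gmono_eval M1 (real N)) +
          (MM_germ r1 (real N) - MM_germ ((A2, B2, M2) # r2) (real N)) = 0"
        using that(4) by eventually_elim (simp add: algebra_simps)
      from leading_coefficients_zero[OF eventually_gmono_eval_pos[OF g(1)] this lim]
      show False using that(2) by (simp add: MM_Cons)
    qed
    have germ: "germ_eq (gmono_eval M) (gmono_eval M')"
      using growth_monomial_trichotomy[OF gM gM'] not_dom[OF _ M M' eq]
        not_dom[OF _ M' M eventually_mono[OF eq sym]] by blast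
    \<comment> \<open>The remainder of \<open>c'\<close> is measured against \<open>M\<close>
      instead of \<open>M'\<close>, so that both remainders share one denominator.\<close>
    have "\<forall>\<^sub>F N in sequentially. MM_germ r' (real N) / of_real (gmono_eval M' (real N)) =
        MM_germ r' (real N) / complex_of_real (gmono_eval M (real N))"
      using eventually_sequentially_real[OF germ[unfolded germ_eq_def]] by eventually_elim simp
    with limr' have "(\<lambda>N. MM_germ r' (real N) / of_real (gmono_eval M (real N))) \<longlonglongrightarrow> 0"
      by (rule Lim_transform_eventually)
    from tendsto_diff[OF limr this]
    have lim: "(\<lambda>N. (MM_germ r (real N) - MM_germ r' (real N)) / of_real (gmono_eval M (real N))) \<longlonglongrightarrow> 0"
      by (simp add: diff_divide_distrib)
    have "\<forall>\<^sub>F N in sequentially. ((A - A') + (B - B') * (-1) ^ N) * of_real (gmono_eval M (real N)) +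
        (MM_germ r (real N) - MM_germ r' (real N)) = 0"
      using eq eventually_sequentially_real[OF germ[unfolded germ_eq_def]]
      by eventually_elim (simp add: algebra_simps)
    from leading_coefficients_zero[OF posM this lim] have AB: "A = A'" "B = B'" by simp_all
    have "\<forall>\<^sub>F N in sequentially. MM_germ r (real N) = MM_germ r' (real N)"
      using eq eventually_sequentially_real[OF germ[unfolded germ_eq_def]]
      by eventually_elim (simp add: AB)
    then have "list_all2 (\<lambda>(A, B, M) (A', B', M'). A = A' \<and> B = B' \<and> growth_monomial M \<and>
           growth_monomial M' \<and> germ_eq (gmono_eval M) (gmono_eval M')) r r'"
      using Cons.IH[of r'] M M' by (simp add: MM_Cons)
    then show ?thesis using AB germ gM gM' by (simp add: c' p p')
  qed
qed

lemma phase_continuation_unique: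
  assumes "list_all2 (\<lambda>(A, B, M) (A', B', M'). A = A' \<and> B = B' \<and> growth_monomial M \<and>
           growth_monomial M' \<and> germ_eq (gmono_eval M) (gmono_eval M')) c c'"
  shows "\<forall>\<^sub>F s in at_top. \<forall>z\<in>right_half_plane s.
           continuation (phase_plus c) z = continuation (phase_plus c') z \<and>
           continuation (phase_minus c) z = continuation (phase_minus c') z"
  using assms
proof (induction rule: list_all2_induct)
  case (Cons p c p' c')
  obtain A B M A' B' M' where p: "p = (A, B, M)" "p' = (A', B', M')" using prod_cases3 by metis
  with Cons have AB: "A = A'" "B = B'" and
    "\<forall>\<^sub>F s in at_top. \<forall>z\<in>right_half_plane s. gmono_eval M z = gmono_eval M' z"
    using gmono_eval_continuation_unique by auto
  from this(3) Cons.IH show ?case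
    by eventually_elim (auto simp: p AB)
qed simp

section \<open>Selectors\<close>

text \<open>The transform is read off from lines arbitrarily far to the right, so agreement of the
  continuations on one right half-plane suffices.\<close>

lemma bromwich_cong:
  assumes "\<forall>\<^sub>F s in at_top. \<forall>z\<in>right_half_plane s. continuation a z = continuation a' z"
  shows "bromwich a = bromwich a'"
proof -
  obtain s0 where s0: "\<forall>z\<in>right_half_plane s0. continuation a z = continuation a' z"
    using assms by (force simp: eventually_at_top_linorder)
  have "bromwich_line a s u = bromwich_line a' s u" if "s > s0" for s u
    using s0 that by (simp add: bromwich_line_def bromwich_integrand_def)
  then have ev: "\<forall>\<^sub>F s in at_top. bromwich_line a s u = bromwich_line a' s u" for u
    by (auto intro: eventually_mono[OF eventually_gt_at_top[of s0]])
  have "\<forall>\<^sub>F s in at_top. (bromwich_line a s u = v) = (bromwich_line a' s u = v)" for u v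
    using ev[of u] by eventually_elim simp
  from eventually_subst[OF this]
  have "(\<forall>\<^sub>F s in at_top. bromwich_line a s u = v) \<longleftrightarrow> (\<forall>\<^sub>F s in at_top. bromwich_line a' s u = v)"
    for u v .
  then show ?thesis by (simp add: bromwich_def fun_eq_iff)
qed

text \<open>Agreement at large integers gives germ-equal terms, hence equal continuations far to the
  right and equal Bromwich transforms. The selectors are built from the transforms alone, so they
  coincide at every index and not only eventually.\<close>

lemma selector_eq_if_MM_germ_eq:
  assumes "c \<in> MM" "c' \<in> MM"
    and "\<forall>\<^sub>F N in sequentially. MM_germ c (real N) = MM_germ c' (real N)"
  shows "selector c = selector c'"
proof -
  note ev = phase_continuation_unique[OF MM_expression_unique[OF assms]]
  have "bromwich (phase_plus c) = bromwich (phase_plus c')"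
    "bromwich (phase_minus c) = bromwich (phase_minus c')"
    by (rule bromwich_cong, use ev in eventually_elim, simp)+
  then have "sel_plus_integrand (phase_plus c) = sel_plus_integrand (phase_plus c')"
    "sel_minus_integrand (phase_minus c) = sel_minus_integrand (phase_minus c')"
    by (simp_all add: fun_eq_iff sel_plus_integrand_def sel_minus_integrand_def)
  then have "sel_plus (phase_plus c) = sel_plus (phase_plus c')"
    "sel_minus (phase_minus c) = sel_minus (phase_minus c')"
    by (simp_all add: sel_plus_def[abs_def] sel_minus_def[abs_def] sel_plus_truncated_def[abs_def])
  then show ?thesis by (simp add: selector_def[abs_def])
qed

section \<open>The selector solves the difference equation\<close>

lemma continuation_phases_of_nat:
  "\<forall>\<^sub>F N in sequentially. continuation (phase_plus c) (of_nat N) +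
     (-1) ^ N * continuation (phase_minus c) (of_nat N) = MM_germ c (real N)"
proof (induction c)
  case (Cons p c)
  obtain A B M where p: "p = (A, B, M)" using prod_cases3 by blast
  from Cons.IH eventually_sequentially_real[OF gmono_eval_of_real[of M]] show ?case
    by eventually_elim (auto simp: p algebra_simps)
qed simp

text \<open>The kernel cancels because
  \<open>exp (N * u) + exp ((N + 1) * u) = exp (N * u) * (1 + exp u)\<close>. A sum is the right
  combination here, since the sign \<open>(-1) ^ N\<close> in the selector alternates.\<close>

lemma sel_minus_add:
  assumes "sel_minus_exists a N" "sel_minus_exists a (Suc N)"
  shows "sel_minus a N + sel_minus a (Suc N) = (LINT u|lborel. bromwich a u * of_real (exp (real N * u)))"
proof -
  have "sel_minus_integrand a N u + sel_minus_integrand a (Suc N) u =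
      bromwich a u * of_real (exp (real N * u))" for u
  proof -
    have "1 + exp u \<noteq> 0" using exp_gt_zero[of u] by linarith
    then have "complex_of_real (1 + exp u) \<noteq> 0" by (simp only: of_real_eq_0_iff not_False_eq_True)
    then show ?thesis
      by (simp add: sel_minus_integrand_def divide_simps distrib_right exp_add) (simp add: algebra_simps)
  qed
  then show ?thesis
    using assms unfolding sel_minus_def sel_minus_exists_def
    by (simp flip: Bochner_Integration.integral_add)
qed

text \<open>Away from \<open>u = 0\<close> the factor \<open>1 - exp u\<close> cancels, so the
  truncated integrals differ by a truncated Laplace integral; its integrand is integrable, so
  letting the truncation shrink gives the full integral.\<close>

lemma sel_plus_diff:
  assumes "sel_plus_exists a N" "sel_plus_exists a (Suc N)"
    and int: "integrable lborel (\<lambda>u. bromwich a u * of_real (exp (real N * u)))"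
  shows "sel_plus a N - sel_plus a (Suc N) = (LINT u|lborel. bromwich a u * of_real (exp (real N * u)))"
proof -
  let ?f = "\<lambda>u. bromwich a u * of_real (exp (real N * u))"
  have conv: "(sel_plus_truncated a n \<longlongrightarrow> sel_plus a n) (at_right 0)" if "sel_plus_exists a n" for n
    using that unfolding sel_plus_exists_def sel_plus_def
    by (metis tendsto_Lim trivial_limit_at_right_real)
  have lim: "((\<lambda>e. sel_plus_truncated a N e - sel_plus_truncated a (Suc N) e) \<longlongrightarrow>
      sel_plus a N - sel_plus a (Suc N)) (at_right 0)"
    by (intro tendsto_diff conv assms)
  have diff: "sel_plus_truncated a N e - sel_plus_truncated a (Suc N) e =
      (LINT u:{u. \<bar>u\<bar> > e}|lborel. ?f u)" if "e > 0" for e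
  proof -
    have "sel_plus_integrand a N u - sel_plus_integrand a (Suc N) u = ?f u" if "\<bar>u\<bar> > e" for u
    proof -
      have "1 - exp u \<noteq> 0" using that \<open>e > 0\<close> by auto
      then have "complex_of_real (1 - exp u) \<noteq> 0" by (simp only: of_real_eq_0_iff not_False_eq_True)
      then show ?thesis
        by (simp add: sel_plus_integrand_def divide_simps distrib_right exp_add) (simp add: algebra_simps)
    qed
    moreover have "{u::real. \<bar>u\<bar> > e} \<in> sets lborel" by simp
    ultimately have "(LINT u:{u. \<bar>u\<bar> > e}|lborel. sel_plus_integrand a N u - sel_plus_integrand a (Suc N) u) =
        (LINT u:{u. \<bar>u\<bar> > e}|lborel. ?f u)"
      by (intro set_lebesgue_integral_cong) auto
    then show ?thesis
      using assms(1,2) \<open>e > 0\<close> unfolding sel_plus_truncated_def sel_plus_exists_def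
      by (subst (asm) set_integral_diff) auto
  qed
  \<comment> \<open>A sequence of truncations, since dominated convergence is applied to
    sequences.\<close>
  let ?e = "\<lambda>n. inverse (real (Suc n))"
  have e0: "filterlim ?e (at_right 0) sequentially"
    using LIMSEQ_inverse_real_of_nat
    by (auto simp: filterlim_at simp del: of_nat_Suc intro!: always_eventually)
  from filterlim_compose[OF lim this] have lim': "(\<lambda>n. LINT u:{u. \<bar>u\<bar> > ?e n}|lborel. ?f u) \<longlonglongrightarrow>
      sel_plus a N - sel_plus a (Suc N)"
    by (simp add: diff del: of_nat_Suc)
  have "(\<lambda>n. LINT u:{u. \<bar>u\<bar> > ?e n}|lborel. ?f u) \<longlonglongrightarrow> (LINT u|lborel. ?f u)"
    unfolding set_lebesgue_integral_def
  proof (rule integral_dominated_convergence[where w = "\<lambda>u. norm (?f u)"])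
    \<comment> \<open>Each \<open>u \<noteq> 0\<close> eventually lies outside the removed interval,
      and the point 0 is a null set.\<close>
    show "AE u in lborel. (\<lambda>n. indicator {u. \<bar>u\<bar> > ?e n} u *\<^sub>R ?f u) \<longlonglongrightarrow> ?f u"
      using AE_lborel_singleton[of 0]
    proof eventually_elim
      case (elim u)
      then have "\<forall>\<^sub>F n in sequentially. ?e n < \<bar>u\<bar>"
        using order_tendstoD(2)[OF LIMSEQ_inverse_real_of_nat, of "\<bar>u\<bar>"] by simp
      then have "\<forall>\<^sub>F n in sequentially. ?f u = indicator {u. \<bar>u\<bar> > ?e n} u *\<^sub>R ?f u"
        by eventually_elim simp
      then show ?case by (rule Lim_transform_eventually[OF tendsto_const])
    qed
    show "(\<lambda>u. indicator {u. \<bar>u\<bar> > ?e n} u *\<^sub>R ?f u) \<in> borel_measurable lborel" for n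
      using int by (intro borel_measurable_scaleR borel_measurable_indicator) auto
  qed (use int in \<open>auto simp: indicator_def\<close>)
  with lim' show ?thesis by (rule LIMSEQ_unique)
qed

text \<open>The difference splits into a difference of plus parts and, because of the alternating
  sign, \<open>(-1) ^ N\<close> times a sum of minus parts. Admissibility then replaces the Laplace
  integrals by the values of the two phases.\<close>

lemma selector_difference:
  assumes "admits_selector c"
  shows "\<forall>\<^sub>F N in sequentially. selector c N - selector c (Suc N) = MM_germ c (real N)"
proof -
  let ?P = "\<lambda>N. sel_plus_exists (phase_plus c) N \<and> sel_minus_exists (phase_minus c) N"
  have P: "\<forall>\<^sub>F N in sequentially. ?P N" using assms unfolding admits_selector_def by blast
  then have P': "\<forall>\<^sub>F N in sequentially. ?P (Suc N)"
    by (rule eventually_sequentially_Suc[of ?P, THEN iffD2])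
  have adm: "\<forall>\<^sub>F N in sequentially.
      integrable lborel (\<lambda>u. bromwich a u * of_real (exp (real N * u))) \<and>
      (LINT u|lborel. bromwich a u * of_real (exp (real N * u))) = continuation a (of_nat N)"
    if "bromwich_admissible a" for a
    using that by (simp add: bromwich_admissible_def)
  have "bromwich_admissible (phase_plus c)" "bromwich_admissible (phase_minus c)"
    using assms by (simp_all add: admits_selector_def)
  from P P' this[THEN adm] continuation_phases_of_nat[of c] show ?thesis
  proof eventually_elim
    case (elim N)
    have "sel_plus (phase_plus c) N - sel_plus (phase_plus c) (Suc N) = continuation (phase_plus c) (of_nat N)"
      using elim by (simp add: sel_plus_diff)
    moreover have "sel_minus (phase_minus c) N + sel_minus (phase_minus c) (Suc N) =
        continuation (phase_minus c) (of_nat N)"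
      using elim by (simp add: sel_minus_add)
    ultimately have "(sel_plus (phase_plus c) N - sel_plus (phase_plus c) (Suc N)) +
        (-1) ^ N * (sel_minus (phase_minus c) N + sel_minus (phase_minus c) (Suc N)) = MM_germ c (real N)"
      using elim(5) by simp
    then show ?case by (simp add: selector_def algebra_simps)
  qed
qed

section \<open>Multiplication of expressions, transforms and selectors by a scalar\<close>

definition MM_scale :: "complex \<Rightarrow> (complex \<times> complex \<times> gmono) list \<Rightarrow> (complex \<times> complex \<times> gmono) list" where
  "MM_scale l = map (\<lambda>(A, B, M). (l * A, l * B, M))"

definition flat_scale :: "complex \<Rightarrow> (complex \<times> gmono) list \<Rightarrow> (complex \<times> gmono) list" where
  "flat_scale l = map (\<lambda>(C, M). (l * C, M))"

text \<open>The phases discard zero coefficients, and a nonzero factor does not change which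
  coefficients are zero.\<close>

lemma phase_MM_scale:
  assumes "l \<noteq> 0"
  shows "phase_plus (MM_scale l c) = flat_scale l (phase_plus c)"
    and "phase_minus (MM_scale l c) = flat_scale l (phase_minus c)"
  using assms by (induction c) (auto simp: MM_scale_def flat_scale_def)

lemma MM_scale_in_MM:
  assumes "l \<noteq> 0" "c \<in> MM"
  shows "MM_scale l c \<in> MM"
proof -
  have "sorted_wrt (\<lambda>(_, _, M) (_, _, M'). gmono_eval M \<succ>\<^sub>g gmono_eval M') (MM_scale l c)"
    using assms(2) by (simp add: MM_def MM_scale_def sorted_wrt_map case_prod_unfold)
  with assms show ?thesis by (auto simp: MM_def MM_scale_def)
qed

lemma flat_scale_in_MM_flat:
  assumes "l \<noteq> 0" "a \<in> MM_flat"
  shows "flat_scale l a \<in> MM_flat"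
proof -
  have "sorted_wrt (\<lambda>(_, M) (_, M'). gmono_eval M \<succ>\<^sub>g gmono_eval M') (flat_scale l a)"
    using assms(2) by (simp add: MM_flat_def flat_scale_def sorted_wrt_map case_prod_unfold)
  with assms show ?thesis by (auto simp: MM_flat_def flat_scale_def)
qed

lemma MM_germ_MM_scale: "MM_germ (MM_scale l c) x = l * MM_germ c x"
  by (induction c) (auto simp: MM_germ_def MM_scale_def algebra_simps)

lemma continuation_flat_scale: "continuation (flat_scale l a) z = l * continuation a z"
  by (induction a) (auto simp: flat_scale_def algebra_simps)

lemma bromwich_integrand_flat_scale:
  "bromwich_integrand (flat_scale l a) s u t = l * bromwich_integrand a s u t"
  by (simp add: bromwich_integrand_def continuation_flat_scale)

lemma bromwich_line_flat_scale: "bromwich_line (flat_scale l a) s u = l * bromwich_line a s u"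
  by (simp add: bromwich_line_def bromwich_integrand_flat_scale)

text \<open>Admissibility supplies a value common to all lines far to the right, so that the
  definite description in \<open>bromwich\<close> denotes; \<open>l\<close> times this value
  satisfies the description for the scaled expression.\<close>

lemma bromwich_flat_scale:
  assumes "bromwich_admissible a"
  shows "bromwich (flat_scale l a) u = l * bromwich a u"
  unfolding bromwich_def[of "flat_scale l a"]
proof (rule the_equality)
  obtain s0 where "\<forall>s>s0. \<forall>u. bromwich_line a s u = bromwich a u"
    using assms by (auto simp: bromwich_admissible_def)
  then have "\<forall>\<^sub>F s in at_top. bromwich_line a s u = bromwich a u"
    by (auto intro: eventually_mono[OF eventually_gt_at_top[of s0]])
  then show *: "\<forall>\<^sub>F s in at_top. bromwich_line (flat_scale l a) s u = l * bromwich a u"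
    by eventually_elim (simp add: bromwich_line_flat_scale)
  fix v assume "\<forall>\<^sub>F s in at_top. bromwich_line (flat_scale l a) s u = v"
  with * have "\<forall>\<^sub>F s::real in at_top. v = l * bromwich a u" by eventually_elim simp
  then show "v = l * bromwich a u" by simp
qed

lemma bromwich_admissible_flat_scale:
  assumes "l \<noteq> 0" "bromwich_admissible a"
  shows "bromwich_admissible (flat_scale l a)"
proof -
  obtain s0 where s0: "\<forall>s>s0. AE u in lborel. integrable lborel (bromwich_integrand a s u)"
    "\<forall>s>s0. \<forall>u. bromwich_line a s u = bromwich a u"
    using assms(2) by (auto simp: bromwich_admissible_def)
  have "AE u in lborel. integrable lborel (bromwich_integrand (flat_scale l a) s u)" if "s > s0" for s
    using s0(1)[rule_format, OF that]
  proof eventually_elim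
    case (elim u)
    have "bromwich_integrand (flat_scale l a) s u = (\<lambda>t. l * bromwich_integrand a s u t)"
      by (simp add: fun_eq_iff bromwich_integrand_flat_scale)
    with elim show ?case by simp
  qed
  moreover have "bromwich_line (flat_scale l a) s u = bromwich (flat_scale l a) u" if "s > s0" for s u
    using s0(2) that by (simp add: bromwich_line_flat_scale bromwich_flat_scale[OF assms(2)])
  moreover have "\<forall>\<^sub>F N in sequentially.
        integrable lborel (\<lambda>u. bromwich a u * of_real (exp (real N * u))) \<and>
        (LINT u|lborel. bromwich a u * of_real (exp (real N * u))) = continuation a (of_nat N)"
    using assms(2) by (simp add: bromwich_admissible_def)
  then have "\<forall>\<^sub>F N in sequentially.
        integrable lborel (\<lambda>u. bromwich (flat_scale l a) u * of_real (exp (real N * u))) \<and>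
        (LINT u|lborel. bromwich (flat_scale l a) u * of_real (exp (real N * u))) =
          continuation (flat_scale l a) (of_nat N)"
    by eventually_elim (simp add: bromwich_flat_scale[OF assms(2)] continuation_flat_scale mult.assoc)
  moreover have "flat_scale l a \<in> MM_flat"
    using assms by (intro flat_scale_in_MM_flat) (simp_all add: bromwich_admissible_def)
  ultimately show ?thesis unfolding bromwich_admissible_def by blast
qed

lemma sel_plus_flat_scale:
  assumes "bromwich_admissible a" "sel_plus_exists a N"
  shows "sel_plus_exists (flat_scale l a) N" "sel_plus (flat_scale l a) N = l * sel_plus a N"
proof -
  have integrand: "sel_plus_integrand (flat_scale l a) N = (\<lambda>u. l * sel_plus_integrand a N u)"
    by (simp add: fun_eq_iff sel_plus_integrand_def bromwich_flat_scale[OF assms(1)])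
  have truncated: "sel_plus_truncated (flat_scale l a) N = (\<lambda>e. l * sel_plus_truncated a N e)"
    by (simp add: fun_eq_iff sel_plus_truncated_def integrand set_lebesgue_integral_def
        flip: mult_scaleR_right)
  obtain v where v: "(sel_plus_truncated a N \<longlongrightarrow> v) (at_right 0)"
    using assms(2) by (auto simp: sel_plus_exists_def)
  then have lv: "(sel_plus_truncated (flat_scale l a) N \<longlongrightarrow> l * v) (at_right 0)"
    unfolding truncated by (intro tendsto_intros)
  then show "sel_plus_exists (flat_scale l a) N"
    using assms(2) unfolding sel_plus_exists_def integrand by (auto intro: set_integrable_mult_right)
  show "sel_plus (flat_scale l a) N = l * sel_plus a N"
    unfolding sel_plus_def using v lv by (metis tendsto_Lim trivial_limit_at_right_real)
qed

lemma sel_minus_flat_scale: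
  assumes "bromwich_admissible a" "sel_minus_exists a N"
  shows "sel_minus_exists (flat_scale l a) N" "sel_minus (flat_scale l a) N = l * sel_minus a N"
proof -
  have integrand: "sel_minus_integrand (flat_scale l a) N = (\<lambda>u. l * sel_minus_integrand a N u)"
    by (simp add: fun_eq_iff sel_minus_integrand_def bromwich_flat_scale[OF assms(1)])
  show "sel_minus_exists (flat_scale l a) N"
    using assms(2) unfolding sel_minus_exists_def integrand by simp
  show "sel_minus (flat_scale l a) N = l * sel_minus a N"
    unfolding sel_minus_def integrand by simp
qed

lemma selector_MM_scale:
  assumes "l \<noteq> 0" "admits_selector c"
  shows "admits_selector (MM_scale l c)"
    and "\<forall>\<^sub>F N in sequentially. selector (MM_scale l c) N = l * selector c N"
proof -
  have adm: "bromwich_admissible (phase_plus c)" "bromwich_admissible (phase_minus c)"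
    and ex: "\<forall>\<^sub>F N in sequentially. sel_plus_exists (phase_plus c) N \<and> sel_minus_exists (phase_minus c) N"
    using assms(2) by (simp_all add: admits_selector_def)
  show "admits_selector (MM_scale l c)"
    unfolding admits_selector_def phase_MM_scale[OF assms(1)]
    using ex by (auto intro!: bromwich_admissible_flat_scale adm assms(1)
        sel_plus_flat_scale sel_minus_flat_scale elim!: eventually_mono)
  show "\<forall>\<^sub>F N in sequentially. selector (MM_scale l c) N = l * selector c N"
    using ex unfolding selector_def phase_MM_scale[OF assms(1)]
    by eventually_elim (simp add: sel_plus_flat_scale adm sel_minus_flat_scale algebra_simps)
qed

section \<open>Finite parts and \<open>C\<close>-sums\<close>

lemma eventually_constant:
  fixes f :: "nat \<Rightarrow> 'a"
  assumes "\<forall>\<^sub>F N in sequentially. f (Suc N) = f N"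
  shows "\<exists>v. \<forall>\<^sub>F N in sequentially. f N = v"
proof -
  obtain N0 where N0: "\<And>N. N \<ge> N0 \<Longrightarrow> f (Suc N) = f N"
    using assms by (auto simp: eventually_sequentially)
  have "f N = f N0" if "N \<ge> N0" for N
    using that by (induction rule: dec_induct) (simp_all add: N0)
  then show ?thesis by (auto simp: eventually_sequentially)
qed

lemma represents_difference_selector:
  assumes "represents_difference R c"
  shows "\<forall>\<^sub>F N in sequentially. selector c N - selector c (Suc N) = R N - R (Suc N)"
proof -
  have "\<forall>\<^sub>F N in sequentially. MM_germ c (real N) = R N - R (Suc N)" "admits_selector c"
    using assms by (simp_all add: represents_difference_def)
  from this(1) selector_difference[OF this(2)] show ?thesis by eventually_elim simp
qed

text \<open>\<open>R\<close> and the selector eventually have the same differences, so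
  \<open>R\<close> minus the selector is eventually constant.\<close>

lemma has_finite_part_exists:
  assumes "M_admissible R"
  shows "\<exists>v. has_finite_part R v"
proof (cases "\<forall>\<^sub>F N in sequentially. R N - R (Suc N) = 0")
  case True
  then have "\<forall>\<^sub>F N in sequentially. R (Suc N) = R N" by eventually_elim simp
  from eventually_constant[OF this] show ?thesis using True by (simp add: has_finite_part_def)
next
  case False
  with assms obtain c where c: "represents_difference R c" by (auto simp: M_admissible_def)
  have "\<forall>\<^sub>F N in sequentially. R (Suc N) - selector c (Suc N) = R N - selector c N"
    using represents_difference_selector[OF c] by eventually_elim (simp add: algebra_simps)
  from eventually_constant[OF this] c show ?thesis
    unfolding has_finite_part_def using False by auto
qed

text \<open>Two expressions representing the difference agree at large integers, hence have the same
  selector.\<close>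

lemma has_finite_part_unique:
  assumes "has_finite_part R v" "has_finite_part R v'"
  shows "v = v'"
proof -
  have eq: "v = v'"
    if "\<forall>\<^sub>F N in sequentially. f N = v" "\<forall>\<^sub>F N in sequentially. f N = v'" for f :: "nat \<Rightarrow> complex"
  proof -
    from that have "\<forall>\<^sub>F N::nat in sequentially. v = v'" by eventually_elim simp
    then show ?thesis by simp
  qed
  show ?thesis
  proof (cases "\<forall>\<^sub>F N in sequentially. R N - R (Suc N) = 0")
    case True
    with assms show ?thesis unfolding has_finite_part_def by (auto intro: eq)
  next
    case False
    with assms obtain c c' where c: "represents_difference R c" "represents_difference R c'"
      "\<forall>\<^sub>F N in sequentially. R N - selector c N = v" "\<forall>\<^sub>F N in sequentially. R N - selector c' N = v'"
      unfolding has_finite_part_def by auto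
    have "\<forall>\<^sub>F N in sequentially. MM_germ c (real N) = R N - R (Suc N)"
      "\<forall>\<^sub>F N in sequentially. MM_germ c' (real N) = R N - R (Suc N)" "c \<in> MM" "c' \<in> MM"
      using c(1,2) by (simp_all add: represents_difference_def)
    moreover from this(1,2) have "\<forall>\<^sub>F N in sequentially. MM_germ c (real N) = MM_germ c' (real N)"
      by eventually_elim simp
    ultimately have "selector c = selector c'" by (intro selector_eq_if_MM_germ_eq)
    with c(3,4) show ?thesis by (auto intro: eq)
  qed
qed

lemma finite_part_eqI: "has_finite_part R v \<Longrightarrow> finite_part R = v"
  unfolding finite_part_def by (blast intro: has_finite_part_unique)

lemma has_finite_part_finite_part: "M_admissible R \<Longrightarrow> has_finite_part R (finite_part R)"
  using has_finite_part_exists finite_part_eqI by metis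

text \<open>A constant cancels in the differences, so the same expressions and selectors serve for
  the translated sequence.\<close>

lemma has_finite_part_add_const:
  assumes "has_finite_part R v"
  shows "has_finite_part (\<lambda>N. R N + d) (v + d)"
proof -
  have "represents_difference (\<lambda>N. R N + d) = represents_difference R"
    by (simp add: fun_eq_iff represents_difference_def)
  moreover have "(R N + d - s = v + d) = (R N - s = v)" for N s
  proof -
    have "R N + d - s = (R N - s) + d" by simp
    then show ?thesis by (simp only: add_right_cancel)
  qed
  ultimately show ?thesis using assms by (simp add: has_finite_part_def)
qed

section \<open>Finite parts under scaling and of convergent sequences\<close>

lemma shift_nonresonant_scale:
  assumes "shift_nonresonant U" "\<forall>\<^sub>F N in sequentially. V N = l * U N"
  shows "shift_nonresonant V"
  using assms(1) unfolding shift_nonresonant_def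
proof (elim disjE exE conjE)
  assume "U \<longlonglongrightarrow> 0"
  then have "(\<lambda>N. l * U N) \<longlonglongrightarrow> 0" by (rule tendsto_mult_right_zero)
  then have "V \<longlonglongrightarrow> 0"
    by (rule Lim_transform_eventually) (use assms(2) in eventually_elim, simp)
  then show "V \<longlonglongrightarrow> 0 \<or> (\<exists>e>0. \<exists>N0. \<forall>N\<ge>N0. norm (V N - V (Suc N)) \<ge> e * norm (V N))" ..
next
  fix e N0 assume e: "e > 0" and N0: "\<forall>N\<ge>N0. norm (U N - U (Suc N)) \<ge> e * norm (U N)"
  obtain N1 where N1: "\<And>N. N \<ge> N1 \<Longrightarrow> V N = l * U N"
    using assms(2) by (auto simp: eventually_sequentially)
  have "norm (V N - V (Suc N)) \<ge> e * norm (V N)" if "N \<ge> max N0 N1" for N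
  proof -
    have "norm l * (e * norm (U N)) \<le> norm l * norm (U N - U (Suc N))"
      using N0 that by (intro mult_left_mono) auto
    moreover have V: "V N = l * U N" "V N - V (Suc N) = l * (U N - U (Suc N))"
      using N1[of N] N1[of "Suc N"] that by (simp_all add: right_diff_distrib)
    ultimately show ?thesis unfolding V(2) unfolding V(1) norm_mult by (simp only: mult.left_commute)
  qed
  with e show "V \<longlonglongrightarrow> 0 \<or> (\<exists>e>0. \<exists>N0. \<forall>N\<ge>N0. norm (V N - V (Suc N)) \<ge> e * norm (V N))" by blast
qed

lemma represents_difference_MM_scale:
  assumes "l \<noteq> 0" "represents_difference R c"
  shows "represents_difference (\<lambda>N. l * R N) (MM_scale l c)"
proof -
  have c: "c \<in> MM" "\<forall>\<^sub>F N in sequentially. MM_germ c (real N) = R N - R (Suc N)"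
    "admits_selector c" "shift_nonresonant (selector c)"
    using assms(2) by (simp_all add: represents_difference_def)
  have "\<forall>\<^sub>F N in sequentially. MM_germ (MM_scale l c) (real N) = l * R N - l * R (Suc N)"
    using c(2) by eventually_elim (simp add: MM_germ_MM_scale right_diff_distrib)
  then show ?thesis
    using MM_scale_in_MM[OF assms(1) c(1)] selector_MM_scale[OF assms(1) c(3)]
      shift_nonresonant_scale[OF c(4)]
    unfolding represents_difference_def by blast
qed

lemma has_finite_part_scale:
  assumes "l \<noteq> 0" "has_finite_part R v"
  shows "has_finite_part (\<lambda>N. l * R N) (l * v)"
proof (cases "\<forall>\<^sub>F N in sequentially. R N - R (Suc N) = 0")
  case True
  with assms(2) have "\<forall>\<^sub>F N in sequentially. R N = v" by (simp add: has_finite_part_def)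
  then have "\<forall>\<^sub>F N in sequentially. l * R N = l * v" by eventually_elim simp
  with True show ?thesis by (simp add: has_finite_part_def)
next
  case False
  with assms(2) obtain c where c: "represents_difference R c"
    "\<forall>\<^sub>F N in sequentially. R N - selector c N = v" by (auto simp: has_finite_part_def)
  have "admits_selector c" using c(1) by (simp add: represents_difference_def)
  from c(2) selector_MM_scale(2)[OF assms(1) this]
  have "\<forall>\<^sub>F N in sequentially. l * R N - selector (MM_scale l c) N = l * v"
    by eventually_elim (auto simp: algebra_simps)
  with represents_difference_MM_scale[OF assms(1) c(1)] False assms(1) show ?thesis
    by (auto simp: has_finite_part_def)
qed

lemma M_admissible_scale:
  assumes "M_admissible R"
  shows "M_admissible (\<lambda>N. l * R N)"
proof (cases "l = 0")
  case False
  from assms consider "\<forall>\<^sub>F N in sequentially. R N - R (Suc N) = 0" | c where "represents_difference R c"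
    unfolding M_admissible_def by blast
  then show ?thesis
  proof cases
    case 1
    then have "\<forall>\<^sub>F N in sequentially. l * R N - l * R (Suc N) = 0" by eventually_elim simp
    then show ?thesis by (simp only: M_admissible_def simp_thms)
  next
    case 2
    from represents_difference_MM_scale[OF False this] show ?thesis
      unfolding M_admissible_def by blast
  qed
\<comment> \<open>For \<open>l = 0\<close> a scaled term would have the forbidden coefficient pair
  \<open>(0, 0)\<close>, but the sequence vanishes and is admissible through the first
  alternative.\<close>
qed (simp add: M_admissible_def)

lemma finite_part_scale:
  assumes "M_admissible R"
  shows "finite_part (\<lambda>N. l * R N) = l * finite_part R"
proof (cases "l = 0")
  case True
  then show ?thesis by (intro finite_part_eqI) (simp add: has_finite_part_def)
next
  case False
  from has_finite_part_scale[OF this has_finite_part_finite_part[OF assms]] show ?thesis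
    by (rule finite_part_eqI)
qed

text \<open>The differences of \<open>R\<close> tend to 0 and are eventually those of the selector.
  Shift-nonresonance bounds the selector by a constant times its differences unless it tends to 0
  anyway, so subtracting it does not change the limit of \<open>R\<close>.\<close>

lemma finite_part_eq_limit:
  assumes "M_admissible R" "R \<longlonglongrightarrow> L"
  shows "finite_part R = L"
proof -
  let ?v = "finite_part R"
  have fp: "has_finite_part R ?v" by (rule has_finite_part_finite_part[OF assms(1)])
  show ?thesis
  proof (cases "\<forall>\<^sub>F N in sequentially. R N - R (Suc N) = 0")
    case True
    with fp have "\<forall>\<^sub>F N in sequentially. R N = ?v" by (simp add: has_finite_part_def)
    then have "R \<longlonglongrightarrow> ?v" by (rule tendsto_eventually)
    with assms(2) show ?thesis using LIMSEQ_unique by blast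
  next
    case False
    with fp obtain c where c: "represents_difference R c"
      "\<forall>\<^sub>F N in sequentially. R N - selector c N = ?v" by (auto simp: has_finite_part_def)
    have "(\<lambda>N. R N - R (Suc N)) \<longlonglongrightarrow> L - L"
      by (intro tendsto_diff assms(2) LIMSEQ_Suc)
    then have diff0: "(\<lambda>N. R N - R (Suc N)) \<longlonglongrightarrow> 0" by simp
    have "selector c \<longlonglongrightarrow> 0"
    proof -
      have "shift_nonresonant (selector c)" using c(1) by (simp add: represents_difference_def)
      then consider "selector c \<longlonglongrightarrow> 0" | e N0 where "e > 0"
        "\<forall>N\<ge>N0. norm (selector c N - selector c (Suc N)) \<ge> e * norm (selector c N)"
        unfolding shift_nonresonant_def by blast
      then show ?thesis
      proof cases
        case 2
        have "(\<lambda>N. norm (R N - R (Suc N)) / e) \<longlonglongrightarrow> 0"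
          using tendsto_divide[OF tendsto_norm_zero[OF diff0] tendsto_const[of e]] 2(1) by simp
        moreover have "\<forall>\<^sub>F N in sequentially. norm (selector c N) \<le> norm (R N - R (Suc N)) / e"
          using represents_difference_selector[OF c(1)] eventually_ge_at_top[of N0]
        proof eventually_elim
          case (elim N)
          then have "e * norm (selector c N) \<le> norm (R N - R (Suc N))" using 2(2) by metis
          then show ?case using 2(1) by (simp add: field_simps)
        qed
        ultimately show ?thesis by (rule Lim_null_comparison[rotated])
      qed
    qed
    from tendsto_diff[OF assms(2) this] have "(\<lambda>N. R N - selector c N) \<longlonglongrightarrow> L" by simp
    moreover have "(\<lambda>N. R N - selector c N) \<longlonglongrightarrow> ?v" using c(2) by (rule tendsto_eventually)
    ultimately show ?thesis using LIMSEQ_unique by blast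
  qed
qed

section \<open>Normalized tails and uniqueness of the \<open>C\<close>-sum\<close>

lemma normalized_tail_0 [simp]: "normalized_tail n0 a b I 0 = a n0 * I n0"
  by (simp add: normalized_tail_def rec_prod_def)

lemma rec_prod_Suc: "rec_prod a b (n0 + Suc N) n0 = rec_prod a b (n0 + N) n0 * - (a (n0 + N) / b (n0 + N))"
  by (simp add: rec_prod_def)

text \<open>\<open>rec_prod\<close> solves the homogeneous recurrence, so dividing a solution by it
  turns the recurrence into a difference equation whose right-hand side is the series
  coefficient.\<close>

lemma normalized_tail_diff:
  assumes "rec_presentation n0 a b \<mu> c" "rec_solution n0 a b \<mu> I"
  shows "normalized_tail n0 a b I N - normalized_tail n0 a b I (Suc N) = c N"
proof -
  have nz: "a (n0 + k) \<noteq> 0" "b (n0 + k) \<noteq> 0" for k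
    using assms(1) by (simp_all add: rec_presentation_def)
  define P where "P k = rec_prod a b (n0 + k) n0" for k
  \<comment> \<open>\<open>Q k\<close> is the coefficient of \<open>\<mu> (n0 + k)\<close> in
    \<open>c k\<close>. The product \<open>Q k * P k\<close> telescopes to
    \<open>a n0 / a (n0 + k)\<close>.\<close>
  define Q where "Q k = (-1) ^ k * (\<Prod>j<k. b (n0 + j) / a (n0 + j + 1))" for k
  have P: "P k \<noteq> 0" for k
    using nz by (induction k) (auto simp: P_def rec_prod_def)
  have PQ: "Q k * P k = a n0 / a (n0 + k)" for k
  proof (induction k)
    case 0
    then show ?case using nz[of 0] by (simp add: P_def Q_def rec_prod_def)
  next
    case (Suc k)
    have "P (Suc k) = P k * - (a (n0 + k) / b (n0 + k))"
      unfolding P_def by (rule rec_prod_Suc)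
    moreover have "Q (Suc k) = - Q k * (b (n0 + k) / a (n0 + Suc k))" by (simp add: Q_def)
    ultimately have "Q (Suc k) * P (Suc k) = Q k * P k * (a (n0 + k) / a (n0 + Suc k))"
      using nz(2)[of k] by simp
    with Suc show ?case using nz[of k] by simp
  qed
  \<comment> \<open>The recurrence is isolated by field arithmetic: \<open>u\<close>,
    \<open>w\<close> stand for \<open>a\<close>, \<open>b\<close> at one index, \<open>p\<close> for
    the product up to that index, and \<open>y\<close>, \<open>z\<close> for consecutive values of
    the solution.\<close>
  have step: "x * (y / p) - x * (z / (p * - (u / w))) = x / u / p * (u * y + w * z)"
    if "u \<noteq> 0" "w \<noteq> 0" "p \<noteq> 0" for u w p x y z :: complex
    using that by (simp add: divide_simps) (simp add: algebra_simps)
  have "normalized_tail n0 a b I N - normalized_tail n0 a b I (Suc N) =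
      a n0 / a (n0 + N) / P N * (a (n0 + N) * I (n0 + N) + b (n0 + N) * I (n0 + N + 1))"
    using step[OF nz[of N] P[of N], of "a n0" "I (n0 + N)" "I (n0 + N + 1)"]
    unfolding normalized_tail_def rec_prod_Suc P_def by simp
  also have "a (n0 + N) * I (n0 + N) + b (n0 + N) * I (n0 + N + 1) = \<mu> (n0 + N)"
    using assms(2) by (simp add: rec_solution_def)
  also have "a n0 / a (n0 + N) / P N = Q N"
    unfolding PQ[symmetric] using P[of N] by simp
  also have "Q N * \<mu> (n0 + N) = c N"
    using assms(1) by (simp add: rec_presentation_def Q_def)
  finally show ?thesis .
qed

lemma normalized_tail_partial_sum:
  assumes "rec_presentation n0 a b \<mu> c" "rec_solution n0 a b \<mu> I"
  shows "normalized_tail n0 a b I N = a n0 * I n0 - (\<Sum>k<N. c k)"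
proof (induction N)
  case (Suc N)
  then show ?case using normalized_tail_diff[OF assms, of N] by (simp add: algebra_simps)
qed simp

text \<open>Both tails are a constant minus the same partial sums, so they differ by the constant
  \<open>?d\<close>; the finite part moves by \<open>?d\<close> as well, which cancels the
  difference of the initial terms. A change of solution and a change of presentation are both
  covered.\<close>

lemma C_value_unique:
  assumes "admissible_presentation n0 a b \<mu> I c" "admissible_presentation n0' a' b' \<mu>' I' c"
  shows "C_value n0' a' b' I' = C_value n0 a b I"
proof -
  let ?R = "normalized_tail n0 a b I" and ?R' = "normalized_tail n0' a' b' I'"
  let ?d = "a' n0' * I' n0' - a n0 * I n0"
  have "?R N = a n0 * I n0 - (\<Sum>k<N. c k)" "?R' N = a' n0' * I' n0' - (\<Sum>k<N. c k)" for N
    using assms normalized_tail_partial_sum unfolding admissible_presentation_def by blast+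
  then have "?R' = (\<lambda>N. ?R N + ?d)" by (simp add: fun_eq_iff)
  moreover have "has_finite_part ?R (finite_part ?R)"
    using assms(1) by (intro has_finite_part_finite_part) (simp add: admissible_presentation_def)
  ultimately have "finite_part ?R' = finite_part ?R + ?d"
    by (intro finite_part_eqI) (simp only: has_finite_part_add_const)
  then show ?thesis by (simp add: C_value_def)
qed

lemma has_C_sum_iff:
  assumes "admissible_presentation n0 a b \<mu> I c"
  shows "has_C_sum c v \<longleftrightarrow> v = C_value n0 a b I"
  unfolding has_C_sum_def using assms C_value_unique[OF assms] by blast

lemma C_sum_eq_C_value:
  assumes "admissible_presentation n0 a b \<mu> I c"
  shows "C_sum c = C_value n0 a b I"
  by (simp add: C_sum_def has_C_sum_iff[OF assms])

text \<open>For a convergent series the tail converges to its initial value minus the sum, and the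
  finite part is that limit.\<close>

lemma C_sum_eq_suminf:
  assumes "admissible_presentation n0 a b \<mu> I c" "summable c"
  shows "C_sum c = (\<Sum>k. c k)"
proof -
  have adm: "rec_presentation n0 a b \<mu> c" "rec_solution n0 a b \<mu> I"
    "M_admissible (normalized_tail n0 a b I)"
    using assms(1) by (simp_all add: admissible_presentation_def)
  have "(\<lambda>N. a n0 * I n0 - (\<Sum>k<N. c k)) \<longlonglongrightarrow> a n0 * I n0 - (\<Sum>k. c k)"
    by (intro tendsto_intros summable_LIMSEQ assms(2))
  then have "normalized_tail n0 a b I \<longlonglongrightarrow> a n0 * I n0 - (\<Sum>k. c k)"
    using normalized_tail_partial_sum[OF adm(1,2)] by presburger
  from finite_part_eq_limit[OF adm(3) this] show ?thesis
    by (simp add: C_sum_eq_C_value[OF assms(1)] C_value_def)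
qed

section \<open>Scalar multiples and the shifted series\<close>

lemma normalized_tail_scale:
  "normalized_tail n0 a b (\<lambda>n. l * I n) = (\<lambda>N. l * normalized_tail n0 a b I N)"
  by (simp add: fun_eq_iff normalized_tail_def)

text \<open>Only the right-hand side and the solution are multiplied, so \<open>l = 0\<close> does
  not conflict with the nonvanishing of \<open>a\<close> and \<open>b\<close>.\<close>

lemma admissible_presentation_scale:
  assumes "admissible_presentation n0 a b \<mu> I c"
  shows "admissible_presentation n0 a b (\<lambda>n. l * \<mu> n) (\<lambda>n. l * I n) (\<lambda>k. l * c k)"
proof -
  have "rec_presentation n0 a b (\<lambda>n. l * \<mu> n) (\<lambda>k. l * c k)"
    using assms unfolding admissible_presentation_def rec_presentation_def by simp
  moreover have "rec_solution n0 a b (\<lambda>n. l * \<mu> n) (\<lambda>n. l * I n)"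
    unfolding rec_solution_def
  proof (intro allI impI)
    fix n assume "n \<ge> n0"
    then have "a n * I n + b n * I (n + 1) = \<mu> n"
      using assms by (simp add: admissible_presentation_def rec_solution_def)
    then show "a n * (l * I n) + b n * (l * I (n + 1)) = l * \<mu> n"
      by (metis distrib_left mult.left_commute)
  qed
  moreover have "M_admissible (normalized_tail n0 a b (\<lambda>n. l * I n))"
    using assms unfolding normalized_tail_scale admissible_presentation_def
    by (blast intro: M_admissible_scale)
  ultimately show ?thesis unfolding admissible_presentation_def by blast
qed

lemma C_sum_scale:
  assumes "admissible_presentation n0 a b \<mu> I c"
  shows "C_sum (\<lambda>k. l * c k) = l * C_sum c"
proof -
  have "finite_part (normalized_tail n0 a b (\<lambda>n. l * I n)) = l * finite_part (normalized_tail n0 a b I)"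
    using assms by (simp add: normalized_tail_scale finite_part_scale admissible_presentation_def)
  then show ?thesis
    by (simp add: C_sum_eq_C_value[OF assms] C_value_def right_diff_distrib
        C_sum_eq_C_value[OF admissible_presentation_scale[OF assms]])
qed

text \<open>Starting at \<open>Suc n0\<close> removes the factor \<open>- b n0 / a (Suc n0)\<close>
  from each coefficient. Moving it into the right-hand side and the solution restores the
  coefficients \<open>c (Suc k)\<close> and makes the new tail exactly the old one shifted.\<close>

lemma shifted_presentation:
  assumes "rec_presentation n0 a b \<mu> c" "rec_solution n0 a b \<mu> I"
  defines "l \<equiv> - b n0 / a (Suc n0)"
  shows "rec_presentation (Suc n0) a b (\<lambda>n. l * \<mu> n) (\<lambda>k. c (Suc k))"
    and "rec_solution (Suc n0) a b (\<lambda>n. l * \<mu> n) (\<lambda>n. l * I n)"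
    and "normalized_tail (Suc n0) a b (\<lambda>n. l * I n) = (\<lambda>N. normalized_tail n0 a b I (Suc N))"
proof -
  have nz: "a n \<noteq> 0" "b n \<noteq> 0" if "n \<ge> n0" for n
    using that assms(1) by (simp_all add: rec_presentation_def)
  have "c (Suc k) = (-1) ^ k * (l * \<mu> (Suc n0 + k)) * (\<Prod>j<k. b (Suc n0 + j) / a (Suc n0 + j + 1))" for k
  proof -
    have "c (Suc k) = (-1) ^ Suc k * \<mu> (n0 + Suc k) * (\<Prod>j<Suc k. b (n0 + j) / a (n0 + j + 1))"
      using assms(1) by (simp only: rec_presentation_def)
    also have "(\<Prod>j<Suc k. b (n0 + j) / a (n0 + j + 1)) =
        b n0 / a (Suc n0) * (\<Prod>j<k. b (Suc n0 + j) / a (Suc n0 + j + 1))"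
      by (subst prod.lessThan_Suc_shift) simp
    finally show ?thesis by (simp add: l_def)
  qed
  then show "rec_presentation (Suc n0) a b (\<lambda>n. l * \<mu> n) (\<lambda>k. c (Suc k))"
    using nz unfolding rec_presentation_def by simp
  show "rec_solution (Suc n0) a b (\<lambda>n. l * \<mu> n) (\<lambda>n. l * I n)"
    unfolding rec_solution_def
  proof (intro allI impI)
    fix n assume "n \<ge> Suc n0"
    then have "a n * I n + b n * I (n + 1) = \<mu> n"
      using assms(2) by (simp add: rec_solution_def)
    then show "a n * (l * I n) + b n * (l * I (n + 1)) = l * \<mu> n"
      by (metis distrib_left mult.left_commute)
  qed
  have "rec_prod a b (n0 + Suc N) n0 = - (a n0 / b n0) * rec_prod a b (Suc n0 + N) (Suc n0)" for N
    unfolding rec_prod_def by (subst prod.atLeast_Suc_lessThan) simp_all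
  then show "normalized_tail (Suc n0) a b (\<lambda>n. l * I n) = (\<lambda>N. normalized_tail n0 a b I (Suc N))"
    using nz[of n0] nz[of "Suc n0"] by (simp add: fun_eq_iff normalized_tail_def l_def)
qed

theorem theorem3p1:
  fixes n0 :: nat and a b \<mu> I c :: "nat \<Rightarrow> complex"
  assumes "rec_presentation n0 a b \<mu> c"
    and "rec_solution n0 a b \<mu> I"
    and "M_admissible (normalized_tail n0 a b I)"
  shows "(\<exists>!v. has_finite_part (normalized_tail n0 a b I) v) \<and>
    (\<exists>!v. has_C_sum c v) \<and>
    C_sum c = a n0 * I n0 - finite_part (normalized_tail n0 a b I) \<and>
    (\<forall>I'. rec_solution n0 a b \<mu> I' \<and> M_admissible (normalized_tail n0 a b I') \<longrightarrow>
       C_value n0 a b I' = C_value n0 a b I) \<and>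
    (\<forall>n0' a' b' \<mu>' I'. rec_presentation n0' a' b' \<mu>' c \<and> rec_solution n0' a' b' \<mu>' I' \<and>
         M_admissible (normalized_tail n0' a' b' I') \<longrightarrow>
       C_value n0' a' b' I' = C_value n0 a b I) \<and>
    (summable c \<longrightarrow> C_sum c = (\<Sum>k. c k)) \<and>
    (\<forall>l. C_summable (\<lambda>k. l * c k) \<and> C_sum (\<lambda>k. l * c k) = l * C_sum c) \<and>
    (shift_compatible (normalized_tail n0 a b I) \<longrightarrow>
       C_summable (\<lambda>k. c (Suc k)) \<and> c 0 + C_sum (\<lambda>k. c (Suc k)) = C_sum c)"
proof (intro conjI allI impI)
  let ?R = "normalized_tail n0 a b I"
  have adm: "admissible_presentation n0 a b \<mu> I c"
    using assms by (simp add: admissible_presentation_def)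
  show "\<exists>!v. has_finite_part ?R v"
    using has_finite_part_exists[OF assms(3)] has_finite_part_unique by blast
  show "\<exists>!v. has_C_sum c v" by (simp add: has_C_sum_iff[OF adm])
  show C: "C_sum c = a n0 * I n0 - finite_part ?R"
    by (simp add: C_sum_eq_C_value[OF adm] C_value_def)
  show "C_value n0 a b I' = C_value n0 a b I"
    if "rec_solution n0 a b \<mu> I' \<and> M_admissible (normalized_tail n0 a b I')" for I'
    using C_value_unique[OF adm] that assms(1) unfolding admissible_presentation_def by blast
  show "C_value n0' a' b' I' = C_value n0 a b I"
    if "rec_presentation n0' a' b' \<mu>' c \<and> rec_solution n0' a' b' \<mu>' I' \<and>
         M_admissible (normalized_tail n0' a' b' I')" for n0' a' b' \<mu>' I'
    using C_value_unique[OF adm] that unfolding admissible_presentation_def by blast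
  show "C_sum c = (\<Sum>k. c k)" if "summable c"
    using C_sum_eq_suminf[OF adm that] .
  show "C_summable (\<lambda>k. l * c k)" for l
    using admissible_presentation_scale[OF adm] unfolding C_summable_def by blast
  show "C_sum (\<lambda>k. l * c k) = l * C_sum c" for l
    by (rule C_sum_scale[OF adm])
  assume shift: "shift_compatible ?R"
  define l where "l = - b n0 / a (Suc n0)"
  note shifted = shifted_presentation[OF assms(1,2), folded l_def]
  have adm': "admissible_presentation (Suc n0) a b (\<lambda>n. l * \<mu> n) (\<lambda>n. l * I n) (\<lambda>k. c (Suc k))"
    using shifted shift by (simp add: admissible_presentation_def shift_compatible_def)
  then show "C_summable (\<lambda>k. c (Suc k))" unfolding C_summable_def by blast
  \<comment> \<open>The initial term of the shifted presentation is the second entry of the original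
    tail, so the two initial terms differ by \<open>c 0\<close>; shift compatibility equates the
    finite parts.\<close>
  have "a (Suc n0) * (l * I (Suc n0)) = ?R (Suc 0)"
    using fun_cong[OF shifted(3), of 0] by simp
  moreover have "?R 0 - ?R (Suc 0) = c 0" by (rule normalized_tail_diff[OF assms(1,2)])
  ultimately have "c 0 + a (Suc n0) * (l * I (Suc n0)) = a n0 * I n0" by (simp add: algebra_simps)
  moreover have "C_sum (\<lambda>k. c (Suc k)) = a (Suc n0) * (l * I (Suc n0)) - finite_part ?R"
    using shift by (simp add: C_sum_eq_C_value[OF adm'] C_value_def shifted(3) shift_compatible_def)
  ultimately show "c 0 + C_sum (\<lambda>k. c (Suc k)) = C_sum c"
    unfolding C by (simp add: algebra_simps)
qed

end
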